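(* Let $n\ge1$ and $c$ be integers with $c\ge\lfloor n/2\rfloor$, and let $\mathbf{s}_n\in\mathcal{B}(n,c)$. If $c\ge c_0=\lfloor 3n/4\rfloor$, then $\mathbf{s}_n\in\mathcal{R}(n,c)$ and $nlc(\mathbf{s}_n^\infty)=nlc(\mathbf{s}_n)+add(\mathbf{s}_n)$. Moreover, for even $n$ the tight bound is $$c_0=\begin{cases}\lfloor 3n/4\rfloor-1,& n=8k,\\ \lfloor 3n/4\rfloor,& n=8k+2 \text{ or } n=8k+6,\\ \lfloor 3n/4\rfloor-2,& n=8k+4,\ k\ge2,\end{cases}$$ (with $k$ a nonnegative integer) in the sense that every sequence in $\mathcal{B}(n,c)$ with $c\ge c_0$ belongs to $\mathcal{R}(n,c)$, and (when $c_0-1\ge\lfloor n/2\rfloor$) there exists a sequence in $\mathcal{B}(n,c_0-1)$ that does not belong to $\mathcal{R}(n,c_0-1)$.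
   Context: All sequences are binary (entries in $\mathbb{Z}_2$), $\overline{x}=x\oplus1$, $x\bmod d$ is the least nonnegative residue, and $\mathbf{a}^q$ is the concatenation of $q$ copies of $\mathbf a$. For $\mathbf{s}_n=(s_0,\dots,s_{n-1})$, $\mathbf{s}_j=(s_0,\dots,s_{j-1})$ and $\mathbf{s}_n^\infty$ is the infinite periodic sequence obtained by repeating $\mathbf{s}_n$. A length-$m$ sequence is periodic if it is the concatenation of $m/e$ copies of a length-$e$ sequence for a proper divisor $e$ of $m$, aperiodic otherwise. $nlc(\mathbf{u})$ (nonlinear complexity) of a finite or infinite sequence $\mathbf u$ is the least $L\ge0$ such that some $f:\mathbb{Z}_2^L\to\mathbb{Z}_2$ satisfies $u_{i+L}=f(u_i,\dots,u_{i+L-1})$ for all $i$ for which $u_{i+L}$ is defined. Right circular shift: $R^k(\mathbf{s}_n)=(s_{n-k},\dots,s_{n-1},s_0,\dots,s_{n-k-1})$, $0\le k<n$. For $c\ge\lfloor n/2\rfloor$ and $1\le d\le\min\{n-c,\lfloor n/2\rfloor\}$, $\mathcal{B}(n,c,d)$ is the set of aperiodic length-$n$ sequences $\mathbf{s}_n$ with $\mathbf{s}_d$ aperiodic and $\mathbf{s}_{c+d}=(s_0,\dots,s_{d-1})^q(s_0,\dots,s_{r-1},\overline{s_r})$, where $q=\lfloor(c+d-1)/d\rfloor$, $r=c+d-1-qd$, and $s_{c+d},\dots,s_{n-1}$ are arbitrary; $d$ is called the spacing. $\mathcal{B}(n,c)=\bigcup_{d=1}^{\min\{n-c,\lfloor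 n/2\rfloor\}}\mathcal{B}(n,c,d)$. For $\mathbf{s}_n\in\mathcal{B}(n,c,d)$, $add(\mathbf{s}_n)$ is the integer $t\ge0$ such that $s_{n-1-i}=s_{(d-1-i)\bmod d}$ for $0\le i<t$ and $s_{n-1-t}\neq s_{(d-1-t)\bmod d}$. For $\mathbf{s}_n\in\mathcal{B}(n,c)$, $E(\mathbf{s}_n)=\{R^k(\mathbf{s}_n):0\le k<n\}\cap\mathcal{B}(n,c)$; an element $\tilde{\mathbf s}\in E(\mathbf{s}_n)$ is a (sequence) representative of $\mathbf{s}_n$ if $add(\tilde{\mathbf s})\ge add(\mathbf{a})$ for all $\mathbf a\in E(\mathbf{s}_n)$. $\mathcal{R}(n,c)$ is the set of all representatives in $\mathcal{B}(n,c)$, i.e. all $\mathbf{s}\in\mathcal{B}(n,c)$ with $add(\mathbf{s})\ge add(\mathbf a)$ for every $\mathbf a\in E(\mathbf s)$. *)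

theory Defs
  imports Main
begin

definition periodic :: "bool list \<Rightarrow> bool" where
  "periodic s \<longleftrightarrow> (\<exists>e. 1 \<le> e \<and> e < length s \<and> e dvd length s \<and>
      s = concat (replicate (length s div e) (take e s)))"

definition aperiodic :: "bool list \<Rightarrow> bool" where
  "aperiodic s \<longleftrightarrow> \<not> periodic s"

definition nlc :: "bool list \<Rightarrow> nat" where
  "nlc u = (LEAST L. \<exists>f :: bool list \<Rightarrow> bool.
      \<forall>i. i + L < length u \<longrightarrow> u ! (i + L) = f (take L (drop i u)))"

definition nlc_inf :: "(nat \<Rightarrow> bool) \<Rightarrow> nat" where
  "nlc_inf u = (LEAST L. \<exists>f :: bool list \<Rightarrow> bool.
      \<forall>i. u (i + L) = f (map (\<lambda>j. u (i + j)) [0..<L]))"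

definition per_inf :: "bool list \<Rightarrow> nat \<Rightarrow> bool" where
  "per_inf s = (\<lambda>i. s ! (i mod length s))"

definition rshift :: "nat \<Rightarrow> bool list \<Rightarrow> bool list" where
  "rshift k s = drop (length s - k) s @ take (length s - k) s"

definition Bset_d :: "nat \<Rightarrow> nat \<Rightarrow> nat \<Rightarrow> bool list set" where
  "Bset_d n c d = {s. 1 \<le> d \<and> d \<le> min (n - c) (n div 2) \<and>
      length s = n \<and> aperiodic s \<and> aperiodic (take d s) \<and>
      (let q = (c + d - 1) div d; r = c + d - 1 - q * d in
        take (c + d) s = concat (replicate q (take d s)) @ take r s @ [\<not> s ! r])}"

definition Bset :: "nat \<Rightarrow> nat \<Rightarrow> bool list set" where
  "Bset n c = (\<Union>d \<in> {1..min (n - c) (n div 2)}. Bset_d n c d)"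

text \<open>The spacing d of s in B(n,c) (it is unique).\<close>
definition spacing :: "nat \<Rightarrow> nat \<Rightarrow> bool list \<Rightarrow> nat" where
  "spacing n c s = (THE d. s \<in> Bset_d n c d)"

definition add_d :: "nat \<Rightarrow> bool list \<Rightarrow> nat" where
  "add_d d s = (LEAST t. t < length s \<and>
      s ! (length s - 1 - t) \<noteq> s ! nat ((int d - 1 - int t) mod int d))"

definition add :: "nat \<Rightarrow> nat \<Rightarrow> bool list \<Rightarrow> nat" where
  "add n c s = add_d (spacing n c s) s"

definition Eset :: "nat \<Rightarrow> nat \<Rightarrow> bool list \<Rightarrow> bool list set" where
  "Eset n c s = {rshift k s | k. k < n} \<inter> Bset n c"

definition Rset :: "nat \<Rightarrow> nat \<Rightarrow> bool list set" where
  "Rset n c = {s \<in> Bset n c. \<forall>a \<in> Eset n c s. add n c a \<le> add n c s}"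

definition c0_even :: "nat \<Rightarrow> nat" where
  "c0_even n = (if n mod 8 = 0 then 3 * n div 4 - 1
                else if n mod 8 = 4 then 3 * n div 4 - 2
                else 3 * n div 4)"

end

theory Submission
  imports Defs
begin

text \<open>
  Extend \<open>s\<close> to an \<open>n\<close>-periodic bi-infinite sequence \<open>f\<close> and let \<open>M\<^sub>d\<close> be the set of mismatches
  \<open>f j \<noteq> f (j + d)\<close>. A shift of \<open>s\<close> in \<open>B(n,c)\<close> with spacing \<open>d\<close> is a gap of length \<open>g \<ge> c\<close> between
  consecutive elements of \<open>M\<^sub>d\<close>, and its \<open>add\<close> is \<open>g - c\<close>; the nonlinear complexity of \<open>f\<close> is the largest
  gap over all \<open>d\<close>. So everything depends on whether another distance \<open>d'\<close> can have a larger gap \<open>g'\<close>.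
  The mixed difference \<open>X\<close> of \<open>f\<close> in the directions \<open>d\<close> and \<open>d'\<close> vanishes on an interval of length
  \<open>g - d' - 1\<close> and on one of length \<open>g' - d - 1\<close>, both bounded by nonzero values. If the two intervals start
  at the same place, primitivity of the root of length \<open>d\<close> gives a contradiction. Otherwise they are disjoint,
  and for large \<open>c\<close> they nearly fill a period. A parity count then forces
  \<open>n = 2 (d + d')\<close> and \<open>n - g - d' = n - g' - d \<ge> 1\<close>, where \<open>\<ge> 2\<close> holds if \<open>d\<close> and \<open>d'\<close> are even.
  The sharp bounds are what remains of these equations modulo 8. The extremal sequences have the shape
  \<open>u u v v\<close> with \<open>|u| = d\<close> and \<open>|v| = d'\<close>, where the powers of \<open>u\<close> and \<open>v\<close> have a long common prefix.
\<close>

subsection \<open>Two interleaved gaps\<close>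
text \<open>A maximal run of period \<open>d\<close>: it fills the \<open>g + d - 1\<close>
  positions from \<open>b + 1\<close> to \<open>b + g + d - 1\<close>, and the two mismatches
  prevent an extension on either side.\<close>

definition gap :: "(int \<Rightarrow> bool) \<Rightarrow> int \<Rightarrow> int \<Rightarrow> int \<Rightarrow> bool" where
  "gap f d b g \<longleftrightarrow> 0 < g \<and> f b \<noteq> f (b + d) \<and> f (b + g) \<noteq> f (b + g + d) \<and>
     (\<forall>j. b < j \<longrightarrow> j < b + g \<longrightarrow> f j = f (j + d))"

text \<open>Modulo 2 a mismatch count is the sum of all values compared. Taken together, the two
  counts use each position below \<open>p + q\<close> exactly twice.\<close>

lemma even_card_diff:
  fixes f :: "nat \<Rightarrow> bool"
  shows "even (card {i. i < q \<and> f i \<noteq> f (i + p)} + card {i. i < p \<and> f i \<noteq> f (i + q)})"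
proof -
  define F :: "nat \<Rightarrow> nat" where "F i = of_bool (f i)" for i
  have count: "even (card {i. i < m \<and> f i \<noteq> f (i + k)}) = even (\<Sum>i<m. F i + F (i + k))" for m k
  proof (induction m)
    case (Suc m)
    have "{i. i < Suc m \<and> f i \<noteq> f (i + k)} =
        (if f m \<noteq> f (m + k) then insert m {i. i < m \<and> f i \<noteq> f (i + k)}
         else {i. i < m \<and> f i \<noteq> f (i + k)})"
      by (auto simp: less_Suc_eq)
    then have "card {i. i < Suc m \<and> f i \<noteq> f (i + k)} =
        card {i. i < m \<and> f i \<noteq> f (i + k)} + of_bool (f m \<noteq> f (m + k))"
      by simp
    moreover have "even (of_bool (f m \<noteq> f (m + k)) + (F m + F (m + k)))" by (simp add: F_def)
    ultimately show ?case using Suc.IH by simp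
  qed simp
  have split: "(\<Sum>i<m. F i) + (\<Sum>i<k. F (i + m)) = (\<Sum>i<m + k. F i)" for m k
    by (induction k) (simp_all add: add.commute[of m])
  have "(\<Sum>i<q. F i + F (i + p)) + (\<Sum>i<p. F i + F (i + q)) = 2 * (\<Sum>i<p + q. F i)"
    using split[of p q] split[of q p] by (simp add: sum.distrib add.commute[of q p])
  then have "even ((\<Sum>i<q. F i + F (i + p)) + (\<Sum>i<p. F i + F (i + q)))" by simp
  then show ?thesis unfolding even_add count .
qed

text \<open>By \<open>even_card_diff\<close> the number of mismatches at distance \<open>p\<close>
  is even here, so the one at 0 cannot be alone.\<close>

lemma ex_second_mismatch:
  fixes f :: "nat \<Rightarrow> bool"
  assumes "f 0 \<noteq> f p" "0 < q" "\<And>i. i < p \<Longrightarrow> f i = f (i + q)"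
  shows "\<exists>i. 0 < i \<and> i < q \<and> f i \<noteq> f (i + p)"
proof (rule ccontr)
  assume "\<not> ?thesis"
  then have "{i. i < q \<and> f i \<noteq> f (i + p)} = {0}" using assms(1,2) by (auto intro: gr0I)
  moreover have "{i. i < p \<and> f i \<noteq> f (i + q)} = {}" using assms(3) by auto
  ultimately have "even (card {0::nat} + card ({} :: nat set))"
    using even_card_diff[of q f p] by metis
  then show False by simp
qed

text \<open>Swapping the roles of the two gaps moves \<open>b\<close> to \<open>b + n\<close>, see \<open>swapped\<close> below, so that each fact about
  \<open>A\<close> also holds for \<open>B\<close>.\<close>
locale interleaved_gaps =
  fixes f :: "int \<Rightarrow> bool" and n d d' b b' g g' :: int
  assumes per: "f (j + n) = f j"
    and gap: "gap f d b g" and gap': "gap f d' b' g'"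
    and b_less: "b < b'" "b' < b + n"
    and d_pos: "0 < d" "0 < d'"
    and d_less: "d' < g" "d < g'"
begin

abbreviation "A j \<equiv> f j \<noteq> f (j + d)"
abbreviation "B j \<equiv> f j \<noteq> f (j + d')"
abbreviation "X j \<equiv> A j \<noteq> A (j + d')"

text \<open>\<open>X j\<close> is the sum modulo 2 of \<open>f\<close> at \<open>j\<close>,
  \<open>j + d\<close>, \<open>j + d'\<close> and \<open>j + d + d'\<close>, which is symmetric in
  the two distances.\<close>

lemma X_alt: "X j \<longleftrightarrow> B j \<noteq> B (j + d)"
  by (simp add: add.assoc add.commute[of d d']) blast

lemma A_per: "A (j + n) = A j"
  using per[of j] per[of "j + d"] by (simp add: ac_simps)

lemma A_ends: "A b" "A (b + g)" and A_none: "b < j \<Longrightarrow> j < b + g \<Longrightarrow> \<not> A j"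
  using gap by (auto simp: gap_def)

lemma A_end_n: "A (b + n)"
  using A_per[of b] A_ends(1) by blast

lemma A_none_n: "b + n < j \<Longrightarrow> j < b + n + g \<Longrightarrow> \<not> A j"
  using A_per[of "j - n"] A_none[of "j - n"] by simp

lemma B_ends: "B b'" "B (b' + g')" and B_none: "b' < j \<Longrightarrow> j < b' + g' \<Longrightarrow> \<not> B j"
  using gap' by (auto simp: gap_def)

lemma X_left: "X b'"
  using B_ends(1) B_none[of "b' + d"] d_less d_pos unfolding X_alt by simp

lemma X_right: "X (b' + g' - d)"
proof -
  have "B (b' + g' - d + d)" using B_ends(2) by simp
  moreover have "\<not> B (b' + g' - d)" using B_none[of "b' + g' - d"] d_less d_pos by simp
  ultimately show ?thesis unfolding X_alt by blast
qed

lemma X_none: "b' < j \<Longrightarrow> j < b' + g' - d \<Longrightarrow> \<not> X j"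
  using B_none[of j] B_none[of "j + d"] d_pos unfolding X_alt by simp

text \<open>The gap of \<open>A\<close> makes \<open>X\<close> vanish strictly between
  \<open>b\<close> and \<open>b + g - d'\<close>, but \<open>X\<close> holds at \<open>b'\<close>.
  With \<open>right_nonneg\<close>, the two intervals of zeros are disjoint; the differences of the
  sides in these two lemmas are the overlaps studied below.\<close>

lemma left_nonneg: "b + g \<le> b' + d'"
proof (rule ccontr)
  assume "\<not> ?thesis"
  then have "\<not> A b'" "\<not> A (b' + d')"
    using A_none[of b'] A_none[of "b' + d'"] b_less d_pos d_less by auto
  then show False using X_left by blast
qed

lemma right_nonneg: "b' + g' \<le> b + n + d"
proof (rule ccontr)
  assume *: "\<not> ?thesis"
  have "\<not> A (b + n + d')" using A_none_n[of "b + n + d'"] d_pos d_less by simp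
  then have "X (b + n)" using A_end_n by blast
  moreover have "\<not> X (b + n)" using X_none[of "b + n"] * b_less by simp
  ultimately show False by blast
qed

lemma swapped: "interleaved_gaps f n d' d b' (b + n) g' g"
proof
  have "gap f d (b + n) g"
    unfolding gap_def
  proof (intro conjI allI impI)
    show "0 < g" using gap by (simp add: gap_def)
    show "A (b + n)" by (rule A_end_n)
    show "A (b + n + g)" using A_per[of "b + g"] A_ends(2) by (simp add: ac_simps)
    show "f j = f (j + d)" if "b + n < j" "j < b + n + g" for j using A_none_n[OF that] by blast
  qed
  then show "gap f d (b + n) g" .
qed (use per gap' b_less d_pos d_less in auto)

end

text \<open>\<open>n - g - g' + d + d'\<close> is the total length of the two intervals outside of which \<open>X\<close> is known to vanish.\<close>
locale short_overlap = interleaved_gaps +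
  assumes overlap_less: "n - g - g' + d + d' < d'"
    and sum_le: "d + d' \<le> g'"
begin

text \<open>Going back by \<open>d'\<close> from \<open>j\<close> lands in the gap of
  \<open>A\<close>, so \<open>X (j - d')\<close> is \<open>A j\<close>; for \<open>j\<close> beyond
  \<open>b' + d'\<close> it also lands where \<open>X\<close> vanishes.\<close>

lemma A_head: "b + g \<le> j \<Longrightarrow> j < b + g + d' \<Longrightarrow> A j \<Longrightarrow> j \<le> b' + d'"
proof (rule ccontr)
  assume *: "b + g \<le> j" "j < b + g + d'" "A j" "\<not> j \<le> b' + d'"
  have "\<not> A (j - d')" using A_none[of "j - d'"] * d_less by linarith
  then have "X (j - d')" using *(3) by simp
  moreover have "\<not> X (j - d')"
    using X_none[of "j - d'"] * left_nonneg right_nonneg sum_le overlap_less by linarith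
  ultimately show False by blast
qed

lemma A_tail_X: "b + n - d' < j \<Longrightarrow> j \<le> b + n \<Longrightarrow> X j \<longleftrightarrow> A j"
  using A_none_n[of "j + d'"] d_less by auto

text \<open>The mirror image of \<open>A_head\<close>: going forward by \<open>d'\<close> lands in
  the next copy of the gap of \<open>A\<close>.\<close>

lemma A_tail: "b + n - d' < j \<Longrightarrow> j \<le> b + n \<Longrightarrow> A j \<Longrightarrow> b' + g' - d \<le> j"
proof (rule ccontr)
  assume *: "b + n - d' < j" "j \<le> b + n" "A j" "\<not> b' + g' - d \<le> j"
  have "\<not> X j" using X_none[of j] * left_nonneg right_nonneg sum_le by linarith
  then show False using A_tail_X[of j] * by blast
qed

text \<open>Parity argument along the progression of step \<open>h\<close> from
  \<open>b + g\<close>. Step 1 gives some further mismatch; step 2, possible for even distances,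
  gives one at an even offset.\<close>

lemma ex_A_head_step:
  fixes h :: nat
  assumes "0 < h" "int h dvd d" "int h dvd d'"
  shows "\<exists>i::nat. 0 < i \<and> int h * int i < d' \<and> A (b + g + int h * int i)"
proof -
  obtain p q where pq: "d = int h * int p" "d' = int h * int q" "0 < q"
  proof -
    obtain x y where "d = int h * x" "d' = int h * y" using assms by (auto elim!: dvdE)
    moreover have "x > 0" "y > 0" using calculation d_pos assms(1) by (auto simp: zero_less_mult_iff)
    ultimately show ?thesis using that[of "nat x" "nat y"] by simp
  qed
  define F where "F i = f (b + g + int h * int i)" for i :: nat
  have Fp: "F (i + p) = f (b + g + int h * int i + d)" for i
    unfolding F_def pq(1) by (simp add: algebra_simps)
  have Fq: "F (i + q) = f (b + g + int h * int i + d')" for i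
    unfolding F_def pq(2) by (simp add: algebra_simps)
  have "\<exists>i. 0 < i \<and> i < q \<and> F i \<noteq> F (i + p)"
  proof (rule ex_second_mismatch)
    show "F 0 \<noteq> F p" using A_ends(2) Fp[of 0] by (simp add: F_def)
    show "F i = F (i + q)" if "i < p" for i
    proof -
      have "int h * int i < d" "0 \<le> int h * int i" using that assms(1) unfolding pq(1) by simp_all
      \<comment> \<open>The \<open>d\<close> positions from \<open>b + g\<close> on lie inside the
        gap of \<open>B\<close>.\<close>
      then have "\<not> B (b + g + int h * int i)"
        using left_nonneg right_nonneg overlap_less sum_le by (intro B_none) linarith+
      then show ?thesis unfolding Fq by (simp add: F_def)
    qed
  qed (use pq in simp)
  then obtain i where "0 < i" "i < q" "F i \<noteq> F (i + p)" by blast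
  then show ?thesis using assms(1) unfolding Fp by (auto simp: F_def pq(2))
qed

lemma ex_A_head: "\<exists>j. b + g < j \<and> j < b + g + d' \<and> A j"
  using ex_A_head_step[of 1] by force

text \<open>The same parity argument, with \<open>f\<close> read backwards from
  \<open>b + n + d\<close>.\<close>

lemma ex_A_tail: "\<exists>j. b + n - d' < j \<and> j < b + n \<and> A j"
proof -
  define F where "F i = f (b + n + d - int i)" for i :: nat
  have Fp: "F (i + nat d) = f (b + n - int i)" for i
    using d_pos by (simp add: F_def algebra_simps)
  have "\<exists>i. 0 < i \<and> i < nat d' \<and> F i \<noteq> F (i + nat d)"
  proof (rule ex_second_mismatch)
    show "F 0 \<noteq> F (nat d)" using A_end_n Fp[of 0] by (simp add: F_def)
    show "F i = F (i + nat d')" if "i < nat d" for i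
    proof -
      have "\<not> B (b + n + d - d' - int i)"
        using left_nonneg right_nonneg overlap_less sum_le that d_pos by (intro B_none) linarith+
      then show ?thesis using d_pos by (simp add: F_def algebra_simps)
    qed
  qed (use d_pos in simp)
  then obtain i where "0 < i" "i < nat d'" "F i \<noteq> F (i + nat d)" by blast
  then have "A (b + n - int i)" unfolding Fp by (auto simp: F_def algebra_simps)
  then show ?thesis using \<open>0 < i\<close> \<open>i < nat d'\<close> d_pos by (intro exI[of _ "b + n - int i"]) auto
qed

lemma overlaps_pos: "b + g < b' + d'" "b' + g' < b + n + d"
proof -
  obtain j where "b + g < j" "j < b + g + d'" "A j" using ex_A_head by blast
  then show "b + g < b' + d'" using A_head[of j] by linarith
  obtain k where "b + n - d' < k" "k < b + n" "A k" using ex_A_tail by blast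
  then show "b' + g' < b + n + d" using A_tail[of k] by linarith
qed

lemma A_shift: "b' < j \<Longrightarrow> j < b' + g' - d \<Longrightarrow> A j = A (j + d')"
  using X_none[of j] by blast

text \<open>\<open>n - g\<close> is the distance from the end of the gap of \<open>A\<close> to its
  next copy. If it is below \<open>d'\<close>, then \<open>b + n\<close> falls under
  \<open>A_head\<close>; if it equals \<open>d'\<close>, the second mismatch of the head falls under
  \<open>A_tail\<close> too. Both leave too little room.\<close>

lemma width_greater: "d' < n - g"
proof (rule ccontr)
  assume "\<not> ?thesis"
  then consider "n - g < d'" | "n - g = d'" by linarith
  then show False
  proof cases
    case 1
    then have "b + n \<le> b' + d'"
      using A_head[of "b + n"] A_end_n left_nonneg right_nonneg sum_le by linarith
    then show False using overlaps_pos(2) sum_le by linarith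
  next
    case 2
    obtain j where "b + g < j" "j < b + g + d'" "A j" using ex_A_head by blast
    then show False using A_head[of j] A_tail[of j] 2 overlap_less by linarith
  qed
qed

text \<open>Otherwise a shift by \<open>d'\<close> carries a tail mismatch into the head, and the
  bounds from \<open>A_head\<close> and \<open>A_tail\<close> contradict
  \<open>overlap_less\<close>.\<close>

lemma width_neq: "n - g \<noteq> 2 * d'"
proof
  assume *: "n - g = 2 * d'"
  obtain j where j: "b + n - d' < j" "j < b + n" "A j" using ex_A_tail by blast
  have tail: "b' + g' - d \<le> j" using A_tail[of j] j by simp
  have "A (j - d') = A (j - d' + d')"
    using left_nonneg right_nonneg overlap_less j * by (intro A_shift) linarith+
  then have "A (j - d')" using j by simp
  then have "j - d' \<le> b' + d'" using A_head[of "j - d'"] j * by linarith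
  then show False using tail overlap_less * by linarith
qed

context
  assumes width_less: "n - g < 2 * d'"
begin

text \<open>Now the head and tail windows intersect. One inequality comes from the mismatch at
  \<open>b + g\<close> copied to \<open>b + g + d'\<close>; the other from the fact that
  \<open>A\<close> holds at \<open>b' + g' - d\<close> if this point lies in both windows.\<close>

lemma overlap_right: "b + n + d - b' - g' = n - g - d'"
proof (rule antisym)
  have "A (b + g) = A (b + g + d')"
    using left_nonneg right_nonneg overlap_less width_greater by (intro A_shift) linarith+
  then have "A (b + g + d')" using A_ends(2) by blast
  then show "n - g - d' \<le> b + n + d - b' - g'"
    using A_tail[of "b + g + d'"] width_less width_greater by linarith
  show "b + n + d - b' - g' \<le> n - g - d'"
  proof (rule ccontr)
    assume *: "\<not> ?thesis"
    let ?j = "b' + g' - d"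
    have "A ?j"
      using A_tail_X[of ?j] X_right left_nonneg right_nonneg overlap_less by linarith
    then have "?j \<le> b' + d'"
      using A_head[of ?j] * left_nonneg right_nonneg sum_le by linarith
    then show False using overlap_less width_greater by linarith
  qed
qed

lemma overlap_left: "b' + d' - b - g = n - g - d'"
proof (rule antisym)
  have "A (b + n - d') = A (b + n - d' + d')"
    using left_nonneg right_nonneg overlap_less width_greater by (intro A_shift) linarith+
  then have "A (b + n - d')" using A_end_n by simp
  then show "n - g - d' \<le> b' + d' - b - g"
    using A_head[of "b + n - d'"] width_less width_greater by linarith
  show "b' + d' - b - g \<le> n - g - d'"
  proof (rule ccontr)
    assume *: "\<not> ?thesis"
    have "\<not> A b'" using A_none[of b'] b_less right_nonneg overlap_less by linarith
    then have "A (b' + d')" using X_left by blast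
    then have "b' + g' - d \<le> b' + d'"
      using A_tail[of "b' + d'"] * right_nonneg overlap_less width_greater by linarith
    then show False using overlap_less width_greater by linarith
  qed
qed

lemma even_overlap:
  assumes "even d" "even d'"
  shows "2 \<le> n - g - d'"
proof -
  obtain i :: nat where i: "0 < i" "2 * int i < d'" "A (b + g + 2 * int i)"
    using ex_A_head_step[of 2] assms by auto
  then have "b + g + 2 * int i \<le> b' + d'" using A_head[of "b + g + 2 * int i"] by simp
  then show ?thesis using overlap_left i(1) by linarith
qed

end
end

section \<open>Gaps of a periodic sequence\<close>

lemma gap_le_period:
  assumes per: "\<And>j. f (j + n) = f j" and "gap f d b g" "0 < n"
  shows "g \<le> n"
proof (rule ccontr)
  assume "\<not> ?thesis"
  then have "f (b + n) = f (b + n + d)" using assms(2,3) by (auto simp: gap_def)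
  moreover have "f (b + n + d) = f (b + d)" using per[of "b + d"] by (simp add: ac_simps)
  ultimately show False using assms(2) per[of b] by (auto simp: gap_def)
qed

lemma gap_translate: "gap (\<lambda>j. f (j + k)) d b g \<longleftrightarrow> gap f d (b + k) g"
proof -
  have "(\<forall>j. b < j \<longrightarrow> j < b + g \<longrightarrow> f (j + k) = f (j + d + k)) \<longleftrightarrow>
        (\<forall>j. b + k < j \<longrightarrow> j < b + k + g \<longrightarrow> f j = f (j + d))" (is "?L \<longleftrightarrow> ?R")
  proof
    assume L: ?L
    show ?R
    proof (intro allI impI)
      fix j assume "b + k < j" "j < b + k + g"
      then show "f j = f (j + d)" using L[rule_format, of "j - k"] by (simp add: algebra_simps)
    qed
  next
    assume R: ?R
    show ?L
    proof (intro allI impI)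
      fix j assume "b < j" "j < b + g"
      then show "f (j + k) = f (j + d + k)" using R[rule_format, of "j + k"] by (simp add: algebra_simps)
    qed
  qed
  then show ?thesis by (simp add: gap_def ac_simps)
qed

lemma periodic_mult:
  fixes f :: "int \<Rightarrow> bool"
  assumes "\<And>j. f (j + e) = f j"
  shows "f (j + k * e) = f j"
proof (induction k rule: int_induct[where k = 0])
  case (step1 i)
  then show ?case using assms[of "j + i * e"] by (simp add: algebra_simps)
next
  case (step2 i)
  then show ?case using assms[of "j + (i - 1) * e"] by (simp add: algebra_simps)
qed simp

lemma chain_period:
  fixes f :: "int \<Rightarrow> bool"
  assumes "\<And>i. i < m \<Longrightarrow> f (x + int i * d) = f (x + int i * d + d)"
  shows "f (x + int m * d) = f x"
  using assms
proof (induction m)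
  case (Suc m)
  then have "f (x + int m * d) = f x" by simp
  moreover have "f (x + int m * d) = f (x + int m * d + d)" using Suc.prems by simp
  ultimately show ?case by (simp add: algebra_simps)
qed simp

text \<open>A second gap longer than the first is possible only in a rigid configuration. Here
  \<open>prim\<close> expresses that the period \<open>d\<close> of the first run is primitive, and
  the inequalities for \<open>c\<close> are what the counting arguments need.\<close>

lemma two_gaps:
  fixes f :: "int \<Rightarrow> bool" and n c d d' b b' g g' :: int
  assumes per: "\<And>j. f (j + n) = f j"
    and gap: "gap f d b g" and gap': "gap f d' b' g'"
    and prim: "\<And>e. 0 \<le> e \<Longrightarrow> e < g \<Longrightarrow> (\<And>j. b < j \<Longrightarrow> j \<le> b + d \<Longrightarrow> f j = f (j + e)) \<Longrightarrow> d dvd e"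
    and d: "0 < d" "0 < d'" "d \<le> n - c" "2 * d \<le> n" "2 * d' \<le> n"
    and g: "c \<le> g" "g < g'"
    and c: "n \<le> 2 * c" "2 * n \<le> 3 * c + 1" "5 * n \<le> 7 * c + 9" "d' \<le> n - c \<or> 3 * n \<le> 4 * c + 3"
  shows "n = 2 * d + 2 * d'" "1 \<le> n - g - d'" "n - g - d' = n - g' - d"
    "even d \<Longrightarrow> even d' \<Longrightarrow> 2 \<le> n - g - d'"
proof -
  have le_n: "g' \<le> n" using gap_le_period[OF per gap'] d by linarith
  \<comment> \<open>Gaps repeat with period \<open>n\<close>, so the second one may be moved to
    start in \<open>[b, b + n)\<close>.\<close>
  define b1 where "b1 = b + (b' - b) mod n"
  have b1: "b \<le> b1" "b1 < b + n" using d by (simp_all add: b1_def)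
  have "b1 = b' + - ((b' - b) div n) * n"
    using div_mult_mod_eq[of "b' - b" n] by (simp add: b1_def algebra_simps)
  moreover have "(\<lambda>j. f (j + - ((b' - b) div n) * n)) = f"
    by (rule ext) (rule periodic_mult[of f n, OF per])
  ultimately have gap1: "gap f d' b1 g'" using gap' gap_translate[of f "- ((b' - b) div n) * n" d' b' g'] by simp
  have neq: "d \<noteq> d'"
  proof
    assume "d = d'"
    then have gap2: "gap f d b1 g'" using gap1 by simp
    \<comment> \<open>For equal distances both gaps join consecutive elements of one set of
      mismatches, so they coincide or are disjoint. The first contradicts \<open>g < g'\<close>, the
      second the length of the period.\<close>
    have "b1 = b \<or> b + g \<le> b1" 
    proof (rule ccontr)
      assume "\<not> (b1 = b \<or> b + g \<le> b1)"
      then have "b < b1" "b1 < b + g" using b1 by linarith+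
      then show False using gap gap2 unfolding gap_def by blast
    qed
    then show False
    proof
      assume "b1 = b" then show False using gap gap2 g by (auto simp: gap_def)
    next
      assume "b + g \<le> b1"
      then have "f (b + n) = f (b + n + d)" using gap2 b1 g c by (auto simp: gap_def)
      moreover have "f (b + n + d) = f (b + d)" using per[of "b + d"] by (simp add: ac_simps)
      ultimately show False using per[of b] gap by (auto simp: gap_def)
    qed
  qed
  have d_less: "d' < g" "d < g'" using neq d g c by linarith+
  \<comment> \<open>For a common start, \<open>prim\<close> gives \<open>d dvd d'\<close>. Steps of
    length \<open>d\<close> inside the first run, then one step of length \<open>d'\<close> inside
    the second, lead from \<open>b + g\<close> to \<open>b + g + d\<close> without a
    mismatch.\<close>
  have "b1 \<noteq> b"
  proof
    assume "b1 = b"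
    then have eq': "f j = f (j + d')" if "b < j" "j < b + g'" for j
      using gap1 that by (auto simp: gap_def)
    have "d dvd d'"
    proof (rule prim)
      show "f j = f (j + d')" if "b < j" "j \<le> b + d" for j using eq' that d_less by simp
    qed (use d d_less in auto)
    then obtain k where k: "d' = d * k" by (elim dvdE)
    then have "1 \<le> k" using d by (simp add: zero_less_mult_iff)
    then have "f (b + g + d - d' + int (nat (k - 1)) * d) = f (b + g + d - d')"
    proof (intro chain_period)
      fix i assume "i < nat (k - 1)"
      then have "int i + 1 \<le> k - 1" by linarith
      then have "(int i + 1) * d \<le> (k - 1) * d" using d by (intro mult_right_mono) auto
      moreover have "0 \<le> int i * d" using d by simp
      ultimately have "int i * d + 2 * d \<le> d'" "0 \<le> int i * d" using k by (auto simp: algebra_simps)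
      then have "b < b + g + d - d' + int i * d" "b + g + d - d' + int i * d < b + g"
        using d d_less by linarith+
      then show "f (b + g + d - d' + int i * d) = f (b + g + d - d' + int i * d + d)"
        using gap by (simp add: gap_def)
    qed
    moreover have "b + g + d - d' + int (nat (k - 1)) * d = b + g"
      using \<open>1 \<le> k\<close> k by (simp add: algebra_simps)
    ultimately have "f (b + g) = f (b + g + d - d')" by (simp only:)
    also have "\<dots> = f (b + g + d - d' + d')"
    proof (rule eq')
      have "d \<le> d'" using \<open>d dvd d'\<close> d by (simp add: zdvd_imp_le)
      then show "b + g + d - d' < b + g'" "b < b + g + d - d'" using d g d_less by linarith+
    qed
    finally show False using gap by (simp add: gap_def)
  qed
  then interpret I: interleaved_gaps f n d d' b b1 g g'
    using b1 d(1,2) d_less by (intro interleaved_gaps.intro per gap gap1) linarith+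
  interpret J: interleaved_gaps f n d' d b1 "b + n" g' g by (rule I.swapped)
  \<comment> \<open>Failure would force equality throughout: \<open>g = c\<close>,
    \<open>g' = c + 1\<close> and \<open>d = n - c\<close>. Then \<open>d' < d\<close>, and the
    swapped configuration contradicts \<open>width_greater\<close>.\<close>
  have less: "n - g - g' + d + d' < d'"
  proof (rule ccontr)
    assume *: "\<not> ?thesis"
    then have eqs: "g = c" "g' = c + 1" "d = n - c" "2 * n = 3 * c + 1"
      using d g c by linarith+
    then have "d' \<le> n - c" using c d by linarith
    then have "d' < d" using neq eqs by linarith
    interpret J: short_overlap f n d' d b1 "b + n" g' g
      using eqs \<open>d' < d\<close> d(1-5) by unfold_locales linarith+
    show False using J.width_greater eqs by linarith
  qed
  have "d + d' \<le> g'" using d g c by linarith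
  with less interpret I: short_overlap f n d d' b b1 g g' by unfold_locales
  have w: "d' < n - g" by (rule I.width_greater)
  interpret J: short_overlap f n d' d b1 "b + n" g' g
    using w d(1-5) g c(1-3) by unfold_locales linarith+
  note * = I.width_greater J.width_greater I.overlaps_pos J.overlaps_pos I.width_neq J.width_neq
  \<comment> \<open>A width of exactly twice the distance is excluded by \<open>width_neq\<close>; a
    larger one would give \<open>7 * c + 10 \<le> 5 * n\<close>.\<close>
  have less2: "n - g < 2 * d'" "n - g' < 2 * d" using * g c by linarith+
  note overlaps = I.overlap_left[OF less2(1)] I.overlap_right[OF less2(1)]
      J.overlap_left[OF less2(2)] J.overlap_right[OF less2(2)]
  \<comment> \<open>The right overlap of \<open>I\<close> is the left overlap of \<open>J\<close>,
    so both configurations evaluate the same quantity.\<close>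
  show eq: "n - g - d' = n - g' - d" using overlaps by linarith
  have "n - g - g' + d + d' = (b1 + d' - b - g) + (b + n + d - b1 - g')" by simp
  also have "\<dots> = (n - g - d') + (n - g - d')" unfolding overlaps(1,2) by (rule refl)
  finally show "n = 2 * d + 2 * d'" using eq by linarith
  show "1 \<le> n - g - d'" using w by linarith
  show "2 \<le> n - g - d'" if "even d" "even d'" using I.even_overlap[OF less2(1) that] .
qed


subsection \<open>Sequences with a given spacing\<close>
text \<open>Integer indices make positions to the left of the first letter available, where
  \<open>add\<close> is measured.\<close>

definition cyc :: "bool list \<Rightarrow> int \<Rightarrow> bool" where
  "cyc s j = s ! nat (j mod int (length s))"

lemma cyc_add_length: "cyc s (j + int (length s)) = cyc s j"
  by (simp add: cyc_def)

lemma cyc_nth: "0 \<le> j \<Longrightarrow> j < int (length s) \<Longrightarrow> cyc s j = s ! nat j"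
  by (simp add: cyc_def)

lemma cyc_of_nat: "i < length s \<Longrightarrow> cyc s (int i) = s ! i"
  by (simp add: cyc_def)

lemma cyc_neg: "- int (length s) \<le> j \<Longrightarrow> j < 0 \<Longrightarrow> cyc s j = s ! nat (int (length s) + j)"
  using cyc_add_length[of s j] cyc_nth[of "j + int (length s)" s] by (simp add: add.commute)

lemma cyc_take: "0 < d \<Longrightarrow> d \<le> length s \<Longrightarrow> cyc (take d s) j = s ! nat (j mod int d)"
  by (simp add: cyc_def min_absorb2 nat_less_iff)

section \<open>Powers of a word and primitive words\<close>

lemma length_concat_replicate: "length (concat (replicate q u)) = q * length u"
  by (induction q) auto

lemma nth_concat_replicate:
  "i < q * length u \<Longrightarrow> concat (replicate q u) ! i = u ! (i mod length u)"
proof (induction q arbitrary: i)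
  case (Suc q)
  show ?case
  proof (cases "i < length u")
    case False
    then have "i mod length u = (i - length u) mod length u" by (simp add: le_mod_geq)
    with False Suc show ?thesis by (simp add: nth_append)
  qed (simp add: nth_append)
qed simp

lemma periodic_iff:
  "periodic u \<longleftrightarrow> (\<exists>e. 1 \<le> e \<and> e < length u \<and> e dvd length u \<and> (\<forall>i<length u. u ! i = u ! (i mod e)))"
proof -
  have "u = concat (replicate (length u div e) (take e u)) \<longleftrightarrow> (\<forall>i<length u. u ! i = u ! (i mod e))"
    if "1 \<le> e" "e < length u" "e dvd length u" for e
  proof -
    have "length u div e * e = length u" using that by simp
    moreover have "concat (replicate (length u div e) (take e u)) ! i = u ! (i mod e)" if "i < length u" for i
      using that nth_concat_replicate[of i "length u div e" "take e u"] \<open>1 \<le> e\<close> \<open>e < length u\<close> calculation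
      by (simp add: min_absorb2)
    ultimately show ?thesis
      using that by (auto simp: list_eq_iff_nth_eq length_concat_replicate min_absorb2)
  qed
  then show ?thesis unfolding periodic_def by blast
qed

lemma periodic_shift:
  assumes "periodic u"
  obtains e where "1 \<le> e" "2 * e \<le> length u" "e dvd length u"
    "\<And>i. i + e < length u \<Longrightarrow> u ! i = u ! (i + e)"
proof -
  obtain e where e: "1 \<le> e" "e < length u" "e dvd length u" "\<forall>i<length u. u ! i = u ! (i mod e)"
    using assms unfolding periodic_iff by blast
  obtain q where q: "length u = e * q" using e(3) by (elim dvdE)
  then have "q \<noteq> 0" "q \<noteq> 1" using e(1,2) by auto
  then have "2 \<le> q" by simp
  then have "2 * e \<le> length u" unfolding q by simp
  then show ?thesis
  proof (rule that[OF e(1) _ e(3)])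
    fix i assume "i + e < length u"
    then show "u ! i = u ! (i + e)" using e(4)[rule_format, of i] e(4)[rule_format, of "i + e"] by simp
  qed
qed

text \<open>By Bezout the gcd of \<open>e\<close> and the length is again a period; if it were a
  proper divisor of the length, \<open>u\<close> would be periodic.\<close>

lemma aperiodic_dvd:
  assumes "aperiodic u" "u \<noteq> []" and shift: "\<And>j. cyc u (j + e) = cyc u j"
  shows "int (length u) dvd e"
proof -
  let ?d = "int (length u)"
  define h where "h = gcd e ?d"
  obtain x y where "x * e + y * ?d = h" using bezout_int[of e ?d] by (auto simp: h_def)
  moreover have "cyc u (j + x * e + y * ?d) = cyc u (j + x * e)" for j
    by (intro periodic_mult cyc_add_length)
  moreover have "cyc u (j + x * e) = cyc u j" for j by (intro periodic_mult shift)
  ultimately have h: "cyc u (j + h) = cyc u j" for j by (metis add.assoc)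
  have h_pos: "0 < h" "h dvd ?d" using assms(2) by (auto simp: h_def)
  have "h = ?d"
  proof (rule ccontr)
    assume "h \<noteq> ?d"
    then have "h < ?d" using h_pos assms(2) zdvd_imp_le by force
    have "u ! i = u ! (i mod nat h)" if "i < length u" for i
    proof -
      have "int i = int i mod h + int i div h * h" by simp
      then have "cyc u (int i) = cyc u (int i mod h)" using periodic_mult[of "cyc u" h, OF h] by metis
      moreover have "int i mod h = int (i mod nat h)" using h_pos by (simp add: zmod_int)
      moreover have "i mod nat h < length u" using that by (meson le_less_trans mod_less_eq_dividend)
      ultimately show ?thesis using that by (simp add: cyc_of_nat)
    qed
    then have "periodic u"
      unfolding periodic_iff using h_pos \<open>h < ?d\<close> by (intro exI[of _ "nat h"]) (auto simp: nat_dvd_iff)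
    then show False using assms(1) by (simp add: aperiodic_def)
  qed
  then show ?thesis by (metis h_def gcd_dvd1)
qed

lemma shift_on_period:
  fixes f :: "int \<Rightarrow> bool"
  assumes "0 < d" and per: "\<And>j. f (j + d) = f j"
    and eq: "\<And>j. x \<le> j \<Longrightarrow> j < x + d \<Longrightarrow> f j = f (j + e)"
  shows "f (j + e) = f j"
proof -
  define i where "i = x + (j - x) mod d"
  have "x \<le> i" "i < x + d" using assms(1) by (simp_all add: i_def)
  then have "f i = f (i + e)" by (rule eq)
  moreover have "j = i + (j - x) div d * d" using div_mult_mod_eq[of "j - x" d] by (simp add: i_def)
  moreover have "f (i + (j - x) div d * d) = f i" "f (i + e + (j - x) div d * d) = f (i + e)"
    by (rule periodic_mult[of f d, OF per])+
  ultimately show ?thesis by (metis add.assoc add.commute)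
qed

text \<open>The flipped letter has index \<open>c + d - 1\<close>, which is congruent to
  \<open>c - 1\<close> modulo \<open>d\<close>; so flipping it means a mismatch at distance
  \<open>d\<close>.\<close>

lemma mem_Bset_d_iff:
  assumes "1 \<le> c"
  shows "s \<in> Bset_d n c d \<longleftrightarrow> 1 \<le> d \<and> d \<le> min (n - c) (n div 2) \<and> length s = n \<and> aperiodic s \<and>
    aperiodic (take d s) \<and> (\<forall>i<c + d - 1. s ! i = s ! (i mod d)) \<and> s ! (c + d - 1) \<noteq> s ! (c - 1)"
proof -
  have "take (c + d) s = concat (replicate ((c + d - 1) div d) (take d s)) @
          take (c + d - 1 - (c + d - 1) div d * d) s @ [\<not> s ! (c + d - 1 - (c + d - 1) div d * d)] \<longleftrightarrow>
      (\<forall>i<c + d - 1. s ! i = s ! (i mod d)) \<and> s ! (c + d - 1) \<noteq> s ! (c - 1)"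
    if d: "1 \<le> d" "d \<le> min (n - c) (n div 2)" "length s = n"
  proof -
    define m where "m = c + d - 1"
    have m: "c + d = Suc m" "m < n" using assms d by (auto simp: m_def)
    have r: "m - m div d * d = m mod d" by (simp add: minus_div_mult_eq_mod)
    define v where "v = concat (replicate (m div d) (take d s)) @ take (m mod d) s"
    have len: "length (concat (replicate (m div d) (take d s))) = m div d * d"
      using d m by (simp add: length_concat_replicate min_absorb2)
    have "m mod d < d" using d by simp
    then have "m mod d \<le> length s" using d by linarith
    then have len_v: "length v = m" by (simp add: v_def len min_absorb2)
    have v: "v ! i = s ! (i mod d)" if "i < m" for i
    proof (cases "i < m div d * d")
      case True
      moreover have "length (take d s) = d" "i mod d < d" using d by auto
      ultimately show ?thesis
        using nth_concat_replicate[of i "m div d" "take d s"]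
        by (simp add: v_def nth_append len)
    next
      case False
      have "i < m div d * d + m mod d" using that by simp
      then have "i - m div d * d < m mod d" using False by linarith
      moreover have "i mod d = i - m div d * d"
      proof -
        have "i = m div d * d + (i - m div d * d)" using False by simp
        then have "i mod d = (i - m div d * d) mod d" by (metis mod_mult_self3)
        then show ?thesis using calculation \<open>m mod d < d\<close> by simp
      qed
      ultimately show ?thesis using False by (simp add: v_def nth_append len)
    qed
    have "take (c + d) s = v @ [\<not> s ! (m mod d)] \<longleftrightarrow> take m s = v \<and> s ! m = (\<not> s ! (m mod d))"
      using m d by (simp add: take_Suc_conv_app_nth)
    also have "take m s = v \<longleftrightarrow> (\<forall>i<m. s ! i = s ! (i mod d))"
      using v len_v m d by (auto simp: list_eq_iff_nth_eq)
    finally have *: "take (c + d) s = v @ [\<not> s ! (m mod d)] \<longleftrightarrow>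
      (\<forall>i<m. s ! i = s ! (i mod d)) \<and> s ! m \<noteq> s ! (m mod d)" by blast
    have "m = c - 1 + d" using assms by (simp add: m_def)
    then have "(c - 1) mod d = m mod d" "c - 1 < m" using d by simp_all
    then have "(\<forall>i<m. s ! i = s ! (i mod d)) \<Longrightarrow> s ! (c - 1) = s ! (m mod d)" by metis
    then show ?thesis using * unfolding v_def m_def[symmetric] r by auto
  qed
  then show ?thesis unfolding Bset_d_def Let_def by blast
qed

locale spaced =
  fixes n c d :: nat and s :: "bool list"
  assumes mem: "s \<in> Bset_d n c d" and half: "n div 2 \<le> c"
begin

lemma bounds: "1 \<le> d" "d \<le> n - c" "d \<le> n div 2" "1 \<le> c" "c + d \<le> n"
  and len: "length s = n"
proof -
  show d: "1 \<le> d" "d \<le> n - c" "d \<le> n div 2" "length s = n"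
    using mem by (auto simp: Bset_d_def)
  show "1 \<le> c" "c + d \<le> n" using half d by linarith+
qed

lemma root_aperiodic: "aperiodic (take d s)"
  and prefix: "i < c + d - 1 \<Longrightarrow> s ! i = s ! (i mod d)"
  and mismatch: "s ! (c + d - 1) \<noteq> s ! (c - 1)"
  using mem unfolding mem_Bset_d_iff[OF bounds(4)] by auto

abbreviation "P \<equiv> cyc (take d s)"

lemma P_per: "P (j + int d) = P j"
  using cyc_add_length[of "take d s"] bounds len by simp

lemma cyc_prefix: "0 \<le> j \<Longrightarrow> j \<le> int (c + d) - 2 \<Longrightarrow> cyc s j = P j"
proof -
  assume j: "0 \<le> j" "j \<le> int (c + d) - 2"
  then have "cyc s j = s ! (nat j mod d)"
    using prefix[of "nat j"] cyc_nth[of j s] bounds len by simp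
  moreover have "nat j mod d = nat (j mod int d)" using j by (simp add: nat_mod_distrib)
  ultimately show ?thesis using bounds len by (simp add: cyc_take)
qed

lemma cyc_mismatch: "cyc s (int c - 1) \<noteq> cyc s (int c - 1 + int d)"
proof -
  have "cyc s (int (c - 1)) = s ! (c - 1)" "cyc s (int (c + d - 1)) = s ! (c + d - 1)"
    using bounds len by (simp_all only: cyc_of_nat)
  moreover have "int c - 1 = int (c - 1)" "int c - 1 + int d = int (c + d - 1)" using bounds by simp_all
  ultimately show ?thesis using mismatch by metis
qed

lemma root_dvd:
  assumes "\<And>j. x \<le> j \<Longrightarrow> j < x + int d \<Longrightarrow> P j = P (j + e)"
  shows "int d dvd e"
proof -
  have "int (length (take d s)) dvd e"
    using root_aperiodic
  proof (rule aperiodic_dvd)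
    show "P (j + e) = P j" for j
      using assms bounds by (intro shift_on_period[of "int d" P x e]) (auto simp: P_per)
  qed (use bounds len in auto)
  then show ?thesis using bounds len by (simp add: min_absorb2)
qed

text \<open>This is \<open>add\<close> computed with the given \<open>d\<close>; it agrees with
  \<open>add n c s\<close> once the spacing is known to be unique.\<close>

definition "t \<equiv> add_d d s"

text \<open>Thus \<open>add\<close> measures how far the root pattern \<open>P\<close> continues to
  the left of position 0.\<close>

lemma add_index:
  assumes "i < n"
  shows "s ! (length s - 1 - i) = s ! nat ((int d - 1 - int i) mod int d) \<longleftrightarrow>
    cyc s (- 1 - int i) = P (- 1 - int i)"
proof -
  have "(int d - 1 - int i) mod int d = (- 1 - int i) mod int d"
    using mod_add_self2[of "- 1 - int i" "int d"] by (simp add: algebra_simps)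
  moreover have "nat (int n + (- 1 - int i)) = n - 1 - i" using assms by simp
  ultimately show ?thesis using assms cyc_neg[of s "- 1 - int i"] bounds len by (simp add: cyc_take)
qed

text \<open>The \<open>LEAST\<close> in \<open>add_d\<close> is therefore attained: if the pattern
  continued over a whole period, the mismatch at \<open>c - 1\<close> would disappear one period
  earlier.\<close>

lemma ex_add_mismatch: "\<exists>i<n. cyc s (- 1 - int i) \<noteq> P (- 1 - int i)"
proof (rule ccontr)
  assume *: "\<not> ?thesis"
  have S: "cyc s j = P j" if "- int n \<le> j" "j \<le> int (c + d) - 2" for j
  proof (cases "j < 0")
    case True
    then have "nat (- 1 - j) < n" "- 1 - int (nat (- 1 - j)) = j" using that by auto
    then show ?thesis using * by metis
  qed (use that cyc_prefix in simp)
  have "cyc s (int c - 1 - int n) = cyc s (int c - 1 - int n + int d)"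
    using S[of "int c - 1 - int n"] S[of "int c - 1 - int n + int d"] bounds P_per by simp
  then show False
    using cyc_mismatch cyc_add_length[of s "int c - 1 - int n"]
      cyc_add_length[of s "int c - 1 - int n + int d"] len by (simp add: algebra_simps)
qed

lemma t_less: "t < n" and t_mismatch: "cyc s (- 1 - int t) \<noteq> P (- 1 - int t)"
  and t_match: "i < t \<Longrightarrow> cyc s (- 1 - int i) = P (- 1 - int i)"
proof -
  have t: "t = (LEAST i. i < n \<and> cyc s (- 1 - int i) \<noteq> P (- 1 - int i))"
    unfolding t_def add_d_def using add_index len by (intro arg_cong[where f = Least] ext) auto
  show "t < n" "cyc s (- 1 - int t) \<noteq> P (- 1 - int t)"
    using LeastI_ex[OF ex_add_mismatch] unfolding t by auto
  then show "cyc s (- 1 - int i) = P (- 1 - int i)" if "i < t"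
    using that not_less_Least[of i "\<lambda>i. i < n \<and> cyc s (- 1 - int i) \<noteq> P (- 1 - int i)"] unfolding t by auto
qed

lemma t_eq_0_iff: "t = 0 \<longleftrightarrow> s ! (n - 1) \<noteq> s ! (d - 1)"
proof -
  have "(int d - 1) mod int d = int d - 1" using bounds by (intro mod_pos_pos_trivial) auto
  moreover have "nat (int d - 1) = d - 1" by simp
  ultimately have "nat ((int d - 1 - int 0) mod int d) = d - 1" by (metis diff_zero of_nat_0)
  then have "s ! (n - 1) = s ! (d - 1) \<longleftrightarrow> cyc s (- 1 - int 0) = P (- 1 - int 0)"
    using add_index[of 0] bounds len by simp
  then show ?thesis using t_mismatch t_match[of 0] by (cases "t = 0") auto
qed

lemma cyc_run: "- int t \<le> j \<Longrightarrow> j \<le> int (c + d) - 2 \<Longrightarrow> cyc s j = P j"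
proof (cases "j < 0")
  case True
  assume "- int t \<le> j"
  then show ?thesis using t_match[of "nat (- 1 - j)"] True by simp
qed (use cyc_prefix in simp)

text \<open>The root pattern reaches from \<open>- t\<close> to \<open>c + d - 2\<close>, which
  turns \<open>add\<close> into the excess of a gap length over \<open>c\<close>.\<close>

lemma run_gap: "gap (cyc s) (int d) (- 1 - int t) (int c + int t)"
  unfolding gap_def
proof (intro conjI allI impI)
  show "0 < int c + int t" using bounds by simp
  show "cyc s (- 1 - int t) \<noteq> cyc s (- 1 - int t + int d)"
    using t_mismatch cyc_run[of "- 1 - int t + int d"] P_per[of "- 1 - int t"] bounds by simp
  have "- 1 - int t + (int c + int t) = int c - 1" by simp
  then show "cyc s (- 1 - int t + (int c + int t)) \<noteq> cyc s (- 1 - int t + (int c + int t) + int d)"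
    using cyc_mismatch by simp
  show "cyc s j = cyc s (j + int d)" if "- 1 - int t < j" "j < - 1 - int t + (int c + int t)" for j
    using that cyc_run[of j] cyc_run[of "j + int d"] P_per[of j] bounds by simp
qed

lemma run_dvd:
  assumes "0 \<le> e" "e < int c + int t"
    and "\<And>j. - 1 - int t < j \<Longrightarrow> j \<le> - 1 - int t + int d \<Longrightarrow> cyc s j = cyc s (j + e)"
  shows "int d dvd e"
proof (rule root_dvd[where x = "- int t"])
  fix j assume "- int t \<le> j" "j < - int t + int d"
  then show "P j = P (j + e)" using assms(3)[of j] cyc_run[of j] cyc_run[of "j + e"] assms(1,2) bounds by simp
qed

end


subsection \<open>Feedback functions and representatives\<close>
text \<open>\<open>W i\<close> stands for the window at \<open>i\<close>, \<open>v i\<close> for the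
  letter after it, and \<open>Q\<close> for the positions where that letter exists.\<close>

lemma ex_feedback_iff:
  "(\<exists>f. \<forall>i. Q i \<longrightarrow> v i = f (W i)) \<longleftrightarrow> (\<forall>i i'. Q i \<longrightarrow> Q i' \<longrightarrow> W i = W i' \<longrightarrow> v i = v i')"
    (is "?L \<longleftrightarrow> ?R")
proof
  assume ?R
  then have "\<forall>i. Q i \<longrightarrow> v i = v (SOME k. Q k \<and> W k = W i)"
    by (metis (mono_tags, lifting) someI_ex)
  then show ?L by (intro exI[of _ "\<lambda>w. v (SOME k. Q k \<and> W k = w)"]) simp
qed metis

text \<open>Periodicity yields an earlier mismatch. The last one before \<open>x + G\<close> would
  start a gap longer than \<open>G\<close>.\<close>

lemma mismatch_bound:
  fixes f :: "int \<Rightarrow> bool" and n x e :: int and G :: nat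
  assumes per: "\<And>j. f (j + n) = f j" and "0 < n"
    and bound: "\<And>b g. gap f e b g \<Longrightarrow> g \<le> int G"
    and eq: "\<And>j. j < G \<Longrightarrow> f (x + int j) = f (x + int j + e)"
  shows "f (x + int G) = f (x + int G + e)"
proof (rule ccontr)
  assume neq: "\<not> ?thesis"
  let ?M = "\<lambda>k. 0 < k \<and> f (x + int G - int k) \<noteq> f (x + int G - int k + e)"
  have "?M (nat n)"
    using neq assms(2) per[of "x + int G - n"] per[of "x + int G - n + e"] by (simp add: algebra_simps)
  then have k: "?M (LEAST k. ?M k)" by (rule LeastI)
  define k where "k = (LEAST k. ?M k)"
  have "gap f e (x + int G - int k) (int k)"
    unfolding gap_def
  proof (intro conjI allI impI)
    show "f j = f (j + e)" if "x + int G - int k < j" "j < x + int G - int k + int k" for j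
    proof -
      have "nat (x + int G - j) < k" using that by linarith
      then have "\<not> ?M (nat (x + int G - j))" unfolding k_def by (rule not_less_Least)
      then show ?thesis using that by simp
    qed
  qed (use k neq in \<open>simp_all add: k_def\<close>)
  then have "k \<le> G" using bound by fastforce
  then show False using k eq[of "G - k"] unfolding k_def[symmetric] by (auto simp: of_nat_diff algebra_simps)
qed

text \<open>Modulo \<open>n\<close>, the distance from \<open>x\<close> to \<open>y\<close> or from
  \<open>y\<close> to \<open>x\<close> is at most \<open>n / 2\<close>, so bounding the gaps at such
  distances suffices.\<close>

lemma window_determines_next:
  fixes f :: "int \<Rightarrow> bool" and n x y :: int and G :: nat
  assumes per: "\<And>j. f (j + n) = f j" and "0 < n"
    and bound: "\<And>e b g. 0 < e \<Longrightarrow> 2 * e \<le> n \<Longrightarrow> gap f e b g \<Longrightarrow> g \<le> int G"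
    and eq: "\<And>j. j < G \<Longrightarrow> f (x + int j) = f (y + int j)"
  shows "f (x + int G) = f (y + int G)"
proof -
  define e where "e = (y - x) mod n"
  have e: "0 \<le> e" "e < n" using assms(2) by (simp_all add: e_def)
  define q where "q = (y - x) div n"
  have y: "y = x + e + q * n" using div_mult_mod_eq[of "y - x" n] by (simp add: e_def q_def)
  have fy: "f (y + j) = f (x + j + e)" for j
    using periodic_mult[of f n "x + j + e" q, OF per] unfolding y by (simp add: ac_simps)
  have fx: "f (x + j) = f (y + j + (n - e))" for j
    using periodic_mult[of f n "x + j" "q + 1", OF per] unfolding y by (simp add: algebra_simps)
  have "2 * e \<le> n \<or> 2 * (n - e) \<le> n" by (simp add: algebra_simps) linarith
  then consider "e \<le> 0" | "0 < e" "2 * e \<le> n" | "2 * (n - e) \<le> n" by linarith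
  then show ?thesis
  proof cases
    case 1
    then show ?thesis using fy[of "int G"] e by simp
  next
    case 2
    then show ?thesis
      using mismatch_bound[where f = f and n = n and x = x and e = e and G = G, OF per] assms(2) bound eq fy by simp
  next
    case 3
    then show ?thesis
      using mismatch_bound[where f = f and n = n and x = y and e = "n - e" and G = G, OF per] assms(2)
        bound[of "n - e"] eq fx e
      by simp
  qed
qed

section \<open>Circular shifts and windows\<close>

lemma length_rshift [simp]: "length (rshift k s) = length s"
  by (simp add: rshift_def)

lemma nth_rshift:
  assumes "k \<le> length s" "i < length s"
  shows "rshift k s ! i = (if i < k then s ! (length s - k + i) else s ! (i - k))"
  using assms by (auto simp: rshift_def nth_append)

lemma cyc_rshift:
  assumes "k \<le> length s" "s \<noteq> []"
  shows "cyc (rshift k s) j = cyc s (j - int k)"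
proof -
  define i where "i = nat (j mod int (length s))"
  have i: "i < length s" "int i = j mod int (length s)" using assms(2) by (simp_all add: i_def nat_less_iff)
  have "cyc s (j - int k) = cyc s (int i - int k)" unfolding cyc_def i(2) by (simp add: mod_diff_left_eq)
  also have "\<dots> = rshift k s ! i"
  proof (cases "i < k")
    case True
    moreover have "nat (int (length s) + (int i - int k)) = length s - k + i" using assms True by linarith
    ultimately show ?thesis using i assms cyc_neg[of s "int i - int k"] by (simp add: nth_rshift)
  next
    case False
    then show ?thesis using i assms cyc_of_nat[of "i - k" s] by (simp add: nth_rshift of_nat_diff)
  qed
  also have "\<dots> = cyc (rshift k s) j" by (simp add: cyc_def i_def)
  finally show ?thesis by simp
qed

lemma take_drop_eq_iff:
  assumes "i + L \<le> length u" "i' + L \<le> length u"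
  shows "take L (drop i u) = take L (drop i' u) \<longleftrightarrow> (\<forall>j<L. u ! (i + j) = u ! (i' + j))"
  using assms by (auto simp: list_eq_iff_nth_eq)

context spaced
begin

text \<open>If \<open>d < e < c\<close>, the primitive root of length \<open>e\<close> would be
  invariant under a shift by \<open>d\<close>. For \<open>n \<le> 3\<close> only spacing 1
  exists.\<close>

lemma spacing_le:
  assumes "s \<in> Bset_d n c e" and "n < 2 * c \<or> n \<le> 3"
  shows "e \<le> d"
proof (rule ccontr)
  assume less: "\<not> e \<le> d"
  interpret E: spaced n c e s using assms(1) half by unfold_locales
  have "e < c" using assms(2) E.bounds bounds less by linarith
  have "int e dvd int d"
  proof (rule E.root_dvd[where x = 0])
    fix j :: int assume "0 \<le> j" "j < 0 + int e"
    then show "E.P j = E.P (j + int d)"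
      using \<open>e < c\<close> less P_per[of j] E.cyc_prefix[of j] E.cyc_prefix[of "j + int d"]
        cyc_prefix[of j] cyc_prefix[of "j + int d"] bounds by simp
  qed
  then show False using less bounds by (simp add: nat_dvd_not_less)
qed

lemma spacing_eq:
  assumes "n < 2 * c \<or> n \<le> 3"
  shows "spacing n c s = d"
  unfolding spacing_def
proof (rule the_equality)
  fix e assume e: "s \<in> Bset_d n c e"
  then interpret E: spaced n c e s using half by unfold_locales
  show "e = d" using spacing_le[OF e assms] E.spacing_le[OF mem assms] by simp
qed (rule mem)

lemma add_eq:
  assumes "n < 2 * c \<or> n \<le> 3"
  shows "add n c s = t"
  using spacing_eq[OF assms] by (simp add: add_def t_def)

text \<open>The equations of \<open>two_gaps\<close> are incompatible with \<open>tight\<close>, by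
  size or by a parity argument modulo 8.\<close>

lemma gap_bound:
  assumes "gap (cyc s) e b g" "0 < e" "2 * e \<le> int n"
    and "n \<le> 2 * c" "2 * n \<le> 3 * c + 1" "5 * n \<le> 7 * c + 9"
    and "e \<le> int (n - c) \<or> 3 * n \<le> 4 * c + 3"
    and tight: "3 * n \<le> 4 * c + 5 \<or> n mod 8 = 4 \<and> 3 * n \<le> 4 * c + 8"
  shows "g \<le> int (c + t)"
proof (rule ccontr)
  assume *: "\<not> ?thesis"
  define G where "G = int c + int t"
  have per: "cyc s (j + int n) = cyc s j" for j using cyc_add_length[of s] len by simp
  note two = two_gaps[where f = "cyc s" and n = "int n" and c = "int c" and d = "int d" and d' = e
    and b = "- 1 - int t" and b' = b and g = G and g' = g]
  have hyps: "0 < int d" "int d \<le> int n - int c" "2 * int d \<le> int n" "int c \<le> G" "G < g"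
    "int n \<le> 2 * int c" "2 * int n \<le> 3 * int c + 1" "5 * int n \<le> 7 * int c + 9"
    "e \<le> int n - int c \<or> 3 * int n \<le> 4 * int c + 3"
    using assms * bounds by (auto simp: G_def)
  have eqs: "int n = 2 * int d + 2 * e" "1 \<le> int n - G - e" "int n - G - e = int n - g - int d"
    "even (int d) \<Longrightarrow> even e \<Longrightarrow> 2 \<le> int n - G - e"
    using hyps assms(1-3) run_gap run_dvd
    by - (rule two; simp add: per G_def)+
  \<comment> \<open>Add \<open>1 \<le> n - G - e\<close> and \<open>1 \<le> n - g - d\<close>, with
    \<open>d + e = n / 2\<close>, \<open>G \<ge> c\<close> and \<open>g \<ge> c + 1\<close>.\<close>
  have "6 \<le> 3 * int n - 4 * int c" using eqs(1-3) hyps by linarith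
  then have mod8: "n mod 8 = 4" "3 * n \<le> 4 * c + 8" using tight by linarith+
  then obtain k where "n = 8 * k + 4" by (metis mod_div_decomp mult.commute)
  then have sum: "int d + e = 4 * int k + 2" using eqs(1) by simp
  then have "even (int d + e)" by simp
  have "int d < e" using eqs(3) hyps by linarith
  have "e - int d \<noteq> 1" using \<open>even (int d + e)\<close> by presburger
  \<comment> \<open>The slack of 8 leaves only this case. Then \<open>d = 2 * k\<close> and
    \<open>e = 2 * k + 2\<close> are even, which demands an overlap of at least 2.\<close>
  then have "e - int d = 2" "int n - G - e = 1" using \<open>int d < e\<close> eqs(1-3) hyps mod8 by linarith+
  moreover from this have "even (int d)" "even e" using sum by presburger+
  ultimately show False using eqs(4) by simp
qed

lemma Rset_member:
  assumes c: "n \<le> 2 * c" "2 * n \<le> 3 * c + 1" "5 * n \<le> 7 * c + 9" "n < 2 * c \<or> n \<le> 3"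
    and tight: "3 * n \<le> 4 * c + 5 \<or> n mod 8 = 4 \<and> 3 * n \<le> 4 * c + 8"
  shows "s \<in> Rset n c"
proof -
  have "add n c a \<le> add n c s" if "a \<in> Eset n c s" for a
  proof -
    obtain k e where k: "a = rshift k s" "k < n" and e: "a \<in> Bset_d n c e"
      using \<open>a \<in> Eset n c s\<close> unfolding Eset_def Bset_def by blast
    interpret a: spaced n c e a using e half by unfold_locales
    have "cyc a = (\<lambda>j. cyc s (j + - int k))"
      unfolding k(1) using cyc_rshift[of k s] k(2) len by (intro ext) fastforce
    then have "gap (cyc s) (int e) (- 1 - int a.t + - int k) (int c + int a.t)"
      using a.run_gap gap_translate[of "cyc s" "- int k"] by metis
    then have "int c + int a.t \<le> int (c + t)"
      by (rule gap_bound) (use a.bounds c tight in auto)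
    then show ?thesis using add_eq a.add_eq c by simp
  qed
  moreover have "s \<in> Bset n c" using mem bounds unfolding Bset_def by auto
  ultimately show ?thesis by (simp add: Rset_def)
qed

text \<open>The windows ending just before \<open>c - 1\<close> and \<open>c + d - 1\<close> agree
  up to length \<open>c - 1\<close> but have different successors, so \<open>c\<close> is a lower
  bound.\<close>

lemma nlc_eq:
  assumes "n \<le> 2 * c"
  shows "nlc s = c"
proof -
  have feedback: "(\<exists>f. \<forall>i. i + L < length s \<longrightarrow> s ! (i + L) = f (take L (drop i s))) \<longleftrightarrow>
      (\<forall>i i'. i + L < n \<longrightarrow> i' + L < n \<longrightarrow> (\<forall>j<L. s ! (i + j) = s ! (i' + j)) \<longrightarrow> s ! (i + L) = s ! (i' + L))" for L
    unfolding ex_feedback_iff using len by (auto simp: take_drop_eq_iff)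
  \<comment> \<open>Two such windows in fact never agree: primitivity gives \<open>d dvd e\<close>,
    and comparing the windows at index \<open>c + d - 1\<close> then contradicts
    \<open>mismatch\<close>.\<close>
  have determined: "s ! (i + c) = s ! (i' + c)"
    if less: "i < i'" "i' + c < n" and eq: "\<forall>j<c. s ! (i + j) = s ! (i' + j)" for i i'
  proof -
    define e where "e = i' - i"
    have dvd: "int d dvd int e"
    proof (rule root_dvd[where x = "int i"])
      fix j assume j: "int i \<le> j" "j < int i + int d"
      define k where "k = nat (j - int i)"
      have k: "k < c" "j = int (i + k)" "int (i + k) + int e = int (i' + k)"
        using j less bounds assms by (auto simp: k_def e_def)
      have "cyc s j = cyc s (j + int e)"
        using eq k(1) less len cyc_of_nat[of "i + k" s] cyc_of_nat[of "i' + k" s] unfolding k(2,3) by simp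
      moreover have "j + int e \<le> int (c + d) - 2" using j less assms by (auto simp: e_def)
      ultimately show "P j = P (j + int e)"
        using j cyc_prefix[of j] cyc_prefix[of "j + int e"] by simp
    qed
    then have "d dvd e" by simp
    then have "d \<le> e" using less by (intro dvd_imp_le) (simp_all add: e_def)
    define k where "k = c + d - 1 - i'"
    have k: "k < c" "i' + k = c + d - 1" "i + k = c + d - 1 - e" "e \<le> c - 1"
      using less \<open>d \<le> e\<close> assms bounds by (auto simp: k_def e_def)
    have "s ! (c + d - 1) = s ! (c + d - 1 - e)" using eq k by metis
    also have "\<dots> = s ! (c - 1)"
    proof -
      obtain q where "e = d * q" using dvd by (auto elim: dvdE)
      then have "c - 1 + d = c + d - 1 - e + q * d" using k bounds by (simp add: mult.commute)
      then have "(c + d - 1 - e) mod d = (c - 1) mod d" by (metis mod_add_self2 mod_mult_self1)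
      then show ?thesis
        using prefix[of "c - 1"] prefix[of "c + d - 1 - e"] k bounds \<open>d \<le> e\<close> by simp
    qed
    finally show ?thesis using mismatch by simp
  qed
  show ?thesis
    unfolding nlc_def feedback
  proof (rule Least_equality)
    show "\<forall>i i'. i + c < n \<longrightarrow> i' + c < n \<longrightarrow> (\<forall>j<c. s ! (i + j) = s ! (i' + j)) \<longrightarrow> s ! (i + c) = s ! (i' + c)"
      using determined by (metis linorder_neqE_nat)
  next
    fix L
    assume *: "\<forall>i i'. i + L < n \<longrightarrow> i' + L < n \<longrightarrow> (\<forall>j<L. s ! (i + j) = s ! (i' + j)) \<longrightarrow> s ! (i + L) = s ! (i' + L)"
    show "c \<le> L"
    proof (rule ccontr)
      assume "\<not> c \<le> L"
      define i where "i = c - 1 - L"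
      have i: "i + L = c - 1" "i + d + L = c + d - 1" using \<open>\<not> c \<le> L\<close> by (auto simp: i_def)
      have "s ! (i + j) = s ! (i + d + j)" if "j < L" for j
      proof -
        have "i + d + j = i + j + d" "i + j < c + d - 1" "i + j + d < c + d - 1" using that i by auto
        then show ?thesis using prefix[of "i + j"] prefix[of "i + j + d"] by (simp only: mod_add_self2)
      qed
      then have "s ! (i + L) = s ! (i + d + L)"
        by (intro *[rule_format]) (use i bounds in auto)
      then show False using i mismatch by simp
    qed
  qed
qed

lemma nlc_inf_eq:
  assumes bound: "\<And>e b g. 0 < e \<Longrightarrow> 2 * e \<le> int n \<Longrightarrow> gap (cyc s) e b g \<Longrightarrow> g \<le> int (c + t)"
  shows "nlc_inf (per_inf s) = c + t"
proof -
  have u: "per_inf s i = cyc s (int i)" for i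
    by (simp add: per_inf_def cyc_def flip: zmod_int)
  have feedback: "(\<exists>f. \<forall>i. per_inf s (i + L) = f (map (\<lambda>j. per_inf s (i + j)) [0..<L])) \<longleftrightarrow>
      (\<forall>i i'. (\<forall>j<L. cyc s (int i + int j) = cyc s (int i' + int j)) \<longrightarrow>
        cyc s (int i + int L) = cyc s (int i' + int L))" for L
    using ex_feedback_iff[of "\<lambda>_. True" "\<lambda>i. per_inf s (i + L)" "\<lambda>i. map (\<lambda>j. per_inf s (i + j)) [0..<L]"]
    by (simp add: u list_eq_iff_nth_eq)
  have per: "cyc s (j + int n) = cyc s j" for j using cyc_add_length[of s] len by simp
  show ?thesis
    unfolding nlc_inf_def feedback
  proof (rule Least_equality)
    show "\<forall>i i'. (\<forall>j<c + t. cyc s (int i + int j) = cyc s (int i' + int j)) \<longrightarrow>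
        cyc s (int i + int (c + t)) = cyc s (int i' + int (c + t))"
    proof (intro allI impI)
      fix i i' assume "\<forall>j<c + t. cyc s (int i + int j) = cyc s (int i' + int j)"
      then show "cyc s (int i + int (c + t)) = cyc s (int i' + int (c + t))"
        using window_determines_next[where f = "cyc s" and n = "int n" and G = "c + t"
          and x = "int i" and y = "int i'", OF per _ bound] bounds by simp
    qed
  next
    fix L
    assume *: "\<forall>i i'. (\<forall>j<L. cyc s (int i + int j) = cyc s (int i' + int j)) \<longrightarrow>
        cyc s (int i + int L) = cyc s (int i' + int L)"
    show "c + t \<le> L"
    proof (rule ccontr)
      assume less: "\<not> c + t \<le> L"
      \<comment> \<open>The window ends just before the copy of the mismatch \<open>c - 1\<close>
        one period later; adding \<open>n\<close> keeps the index natural.\<close>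
      define i where "i = n + c - 1 - L"
      have i: "int i + int L = int c - 1 + int n"
        using less t_less bounds run_gap by (auto simp: i_def)
      have "cyc s (int i + int j) = cyc s (int (i + d) + int j)" if "j < L" for j
      proof -
        have "cyc s (int i + int j - int n) = cyc s (int i + int j - int n + int d)"
          using run_gap i that less unfolding gap_def by auto
        then show ?thesis
          using per[of "int i + int j - int n"] per[of "int i + int j - int n + int d"] by (simp add: algebra_simps)
      qed
      then have "cyc s (int i + int L) = cyc s (int (i + d) + int L)" using * by blast
      moreover have "int (i + d) + int L = int c - 1 + int d + int n" using i by simp
      ultimately show False using i per cyc_mismatch by metis
    qed
  qed
qed

end


subsection \<open>Sequences that are not representatives\<close>
lemma nth_mod_of_shift:
  assumes "\<And>i. i + 1 < c \<Longrightarrow> s ! i = s ! (i + d)" and "i < c + d - 1"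
  shows "s ! i = s ! (i mod d)"
  using assms(2)
proof (induction i rule: less_induct)
  case (less i)
  show ?case
  proof (cases "i < d \<or> d = 0")
    case False
    then have "s ! (i - d) = s ! ((i - d) mod d)" using less by auto
    moreover have "s ! (i - d) = s ! i" using assms(1)[of "i - d"] less.prems False by auto
    moreover have "(i - d) mod d = i mod d" using False by (simp add: le_mod_geq)
    ultimately show ?thesis by simp
  qed auto
qed

text \<open>Aperiodicity of \<open>s\<close> is automatic: a period \<open>e \<le> n / 2\<close>
  would be a multiple of \<open>d\<close> by primitivity of the root, and going back by
  \<open>e\<close> would remove the mismatch.\<close>

lemma Bset_dI:
  assumes d: "1 \<le> d" "d \<le> n - c" "d \<le> n div 2" "length s = n" and c: "n < 2 * c"
    and root: "aperiodic (take d s)"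
    and shift: "\<And>i. i + 1 < c \<Longrightarrow> s ! i = s ! (i + d)" and mismatch: "s ! (c + d - 1) \<noteq> s ! (c - 1)"
  shows "s \<in> Bset_d n c d"
proof -
  have prefix: "s ! i = s ! (i mod d)" if "i < c + d - 1" for i
    using nth_mod_of_shift[OF shift that] .
  have "aperiodic s"
  proof (rule ccontr)
    assume "\<not> aperiodic s"
    then have "periodic s" by (simp add: aperiodic_def)
    then obtain e where e: "1 \<le> e" "2 * e \<le> n" and s: "\<And>i. i + e < n \<Longrightarrow> s ! i = s ! (i + e)"
      using d(4) by (elim periodic_shift) auto
    have "e \<le> n div 2" using e(2) by simp
    have "cyc (take d s) (j + int e) = cyc (take d s) j" for j
    proof (rule shift_on_period[of "int d" _ 0])
      show "cyc (take d s) (j + int d) = cyc (take d s) j" for j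
        using cyc_add_length[of "take d s" j] d by (simp add: min_absorb2)
      fix j :: int assume "0 \<le> j" "j < 0 + int d"
      then obtain i where i: "j = int i" "i < d" by (metis add_0 of_nat_less_iff nonneg_int_cases)
      have "i + e < c + d - 1" "i < c + d - 1" using i \<open>e \<le> n div 2\<close> c e by linarith+
      then have "s ! (i mod d) = s ! ((i + e) mod d)"
        using prefix[of i] prefix[of "i + e"] s[of i] d c by simp
      then show "cyc (take d s) j = cyc (take d s) (j + int e)"
        using d by (simp add: i cyc_take flip: zmod_int of_nat_add)
    qed (use d in simp)
    then have "int d dvd int e"
      using aperiodic_dvd[OF root, of "int e"] d by (cases "s = []") (auto simp: min_absorb2)
    then obtain k where k: "e = d * k" by (auto elim: dvdE)
    then have "1 \<le> k" using e by (cases k) auto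
    then have "d \<le> e" using k by simp
    have "s ! (c + d - 1) = s ! (c + d - 1 - e)"
      using s[of "c + d - 1 - e"] \<open>e \<le> n div 2\<close> c d by simp
    also have "\<dots> = s ! ((c + d - 1 - e) mod d)"
      using prefix[of "c + d - 1 - e"] e \<open>e \<le> n div 2\<close> c by simp
    also have "(c + d - 1 - e) mod d = (c - 1) mod d"
    proof -
      have "c - 1 + d = c + d - 1 - e + k * d" using k \<open>e \<le> n div 2\<close> c by (simp add: mult.commute)
      then show ?thesis by (metis mod_add_self2 mod_mult_self1)
    qed
    also have "s ! ((c - 1) mod d) = s ! (c - 1)" using prefix[of "c - 1"] d c by simp
    finally show False using mismatch by simp
  qed
  then show ?thesis
    using assms prefix by (subst mem_Bset_d_iff) auto
qed

lemma aperiodic_single: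
  assumes "k < length u" "\<And>i. i < length u \<Longrightarrow> u ! i \<longleftrightarrow> i = k"
  shows "aperiodic u"
proof (rule ccontr)
  assume "\<not> aperiodic u"
  then obtain e where e: "1 \<le> e" "2 * e \<le> length u"
    and u: "\<And>i. i + e < length u \<Longrightarrow> u ! i = u ! (i + e)"
    unfolding aperiodic_def not_not by (elim periodic_shift) auto
  consider "k + e < length u" | "e \<le> k" using e(2) assms(1) by linarith
  then show False
  proof cases
    case 1
    then show False using u[of k] assms e by auto
  next
    case 2
    then show False using u[of "k - e"] assms e by auto
  qed
qed

text \<open>It suffices that \<open>add\<close> is 0 for \<open>s\<close> and positive for a shift,
  and both can be read off from the last letter.\<close>

lemma not_RsetI:
  assumes s: "s \<in> Bset_d n c d" and r: "rshift k s \<in> Bset_d n c e" "k < n"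
    and c: "n div 2 \<le> c" and spacing: "spacing n c s = d" "spacing n c (rshift k s) = e"
    and s_last: "s ! (n - 1) \<noteq> s ! (d - 1)" and r_last: "rshift k s ! (n - 1) = rshift k s ! (e - 1)"
  shows "s \<in> Bset n c" "s \<notin> Rset n c"
proof -
  interpret S: spaced n c d s using s c by unfold_locales
  interpret R: spaced n c e "rshift k s" using r(1) c by unfold_locales
  show "s \<in> Bset n c" using s S.bounds unfolding Bset_def by auto
  have "S.t = 0" "R.t \<noteq> 0"
    using s_last r_last S.t_eq_0_iff R.t_eq_0_iff by simp_all
  moreover have "rshift k s \<in> Eset n c s"
    using r R.bounds unfolding Eset_def Bset_def by auto
  ultimately show "s \<notin> Rset n c"
    using spacing unfolding Rset_def add_def S.t_def R.t_def by fastforce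
qed

lemma spacing_eqI: "s \<in> Bset_d n c d \<Longrightarrow> n < 2 * c \<Longrightarrow> spacing n c s = d"
  by (rule spaced.spacing_eq) (auto simp: spaced_def)

text \<open>\<open>s = u u v v\<close> with \<open>u = 0\<^sup>d\<^sup>-\<^sup>1 1\<close> and \<open>v = u 0\<^sup>p\<close>.\<close>
lemma four_ones_example:
  fixes d p n c :: nat and s :: "bool list"
  assumes p: "1 \<le> p" "p < d" and n: "n = 4 * d + 2 * p" and c: "c = 3 * d" and "n < 2 * c"
    and s_def: "s = map (\<lambda>i. i + 1 = d \<or> i + 1 = 2 * d \<or> i + 1 = 3 * d \<or> i + 1 = 4 * d + p) [0..<n]"
  shows "s \<in> Bset n c" "s \<notin> Rset n c"
proof -
  have len: "length s = n" by (simp add: s_def)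
  have s: "s ! i \<longleftrightarrow> i + 1 = d \<or> i + 1 = 2 * d \<or> i + 1 = 3 * d \<or> i + 1 = 4 * d + p" if "i < n" for i
    using that by (simp add: s_def)
  \<comment> \<open>Shifting by \<open>2 * d + 2 * p\<close> would give \<open>v v u u\<close>.
    Starting \<open>p\<close> letters later puts the end of the gap at distance \<open>d + p\<close>
    exactly at \<open>c - 1\<close>.\<close>
  define a where "a = rshift (2 * d + p) s"
  have len_a: "length a = n" by (simp add: a_def len)
  have a: "a ! i \<longleftrightarrow> i + p + 1 = d \<or> i + 1 = 2 * d \<or> i + 1 = 3 * d + p \<or> i + 1 = 4 * d + p" if "i < n" for i
  proof (cases "i < 2 * d + p")
    case True
    then have "a ! i = s ! (2 * d + p + i)"
      using that len n unfolding a_def by (subst nth_rshift) (auto simp: ac_simps)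
    moreover have "2 * d + p + i < n" using True n by linarith
    ultimately show ?thesis using s[of "2 * d + p + i"] True p by linarith
  next
    case False
    have "a ! i = s ! (i - (2 * d + p))"
      using False that len n unfolding a_def by (subst nth_rshift) auto
    moreover obtain j where "i = 2 * d + p + j" using False by (metis le_Suc_ex not_less)
    moreover have "j < n" using calculation that by simp
    ultimately have "a ! i = s ! j" "i = 2 * d + p + j" "j < n" by simp_all
    then show ?thesis using s[of j] that p n by linarith
  qed
  have mem_s: "s \<in> Bset_d n c d"
  proof (rule Bset_dI)
    show "aperiodic (take d s)"
      by (rule aperiodic_single[where k = "d - 1"]) (use p n len s in auto)
    show "s ! i = s ! (i + d)" if "i + 1 < c" for i
    proof -
      have "i < n" "i + d < n" using that p c n by linarith+
      then show ?thesis using s[of i] s[of "i + d"] that p c by linarith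
    qed
    have "c + d - 1 < n" "c - 1 < n" "c + d - 1 + 1 = 4 * d" "c - 1 + 1 = 3 * d" using p c n by linarith+
    then show "s ! (c + d - 1) \<noteq> s ! (c - 1)" using s[of "c + d - 1"] s[of "c - 1"] p by linarith
  qed (use p len n c assms(5) in auto)
  have mem_a: "a \<in> Bset_d n c (d + p)"
  proof (rule Bset_dI)
    show "aperiodic (take (d + p) a)"
      by (rule aperiodic_single[where k = "d - 1 - p"]) (use p n len_a a in auto)
    show "a ! i = a ! (i + (d + p))" if "i + 1 < c" for i
    proof -
      have "i < n" "i + (d + p) < n" using that p c n by linarith+
      then show ?thesis using a[of i] a[of "i + (d + p)"] that p c by linarith
    qed
    have "c + (d + p) - 1 < n" "c - 1 < n" "c + (d + p) - 1 + 1 = 4 * d + p" "c - 1 + 1 = 3 * d"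
      using p c n by linarith+
    then show "a ! (c + (d + p) - 1) \<noteq> a ! (c - 1)"
      using a[of "c + (d + p) - 1"] a[of "c - 1"] p by linarith
  qed (use p len_a n c assms(5) in auto)
  have "s ! (n - 1) \<noteq> s ! (d - 1)" 
  proof -
    have "n - 1 < n" "d - 1 < n" "n - 1 + 1 = 4 * d + 2 * p" "d - 1 + 1 = d" using p n by linarith+
    then show ?thesis using s[of "n - 1"] s[of "d - 1"] p by linarith
  qed
  moreover have "a ! (n - 1) = a ! (d + p - 1)"
  proof -
    have "n - 1 < n" "d + p - 1 < n" "n - 1 + 1 = 4 * d + 2 * p" "d + p - 1 + 1 = d + p" using p n by linarith+
    then show ?thesis using a[of "n - 1"] a[of "d + p - 1"] p by linarith
  qed
  ultimately show "s \<in> Bset n c" "s \<notin> Rset n c"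
    using not_RsetI[OF mem_s mem_a[unfolded a_def]] spacing_eqI[OF mem_s] spacing_eqI[OF mem_a] n c assms(5) p
    by (auto simp: a_def)
qed

text \<open>\<open>s = u u v v\<close> with \<open>u = (01)\<^sup>k 0\<close>, \<open>d = 2 k + 1\<close> and \<open>v = u 01\<close>.\<close>
lemma alternating_example:
  fixes d n c :: nat and s :: "bool list"
  assumes d: "odd d" "3 \<le> d" and n: "n = 4 * d + 4" and c: "c = 3 * d + 1"
    and s_def: "s = map (\<lambda>i. odd (if i < d then i else if i < 2 * d then i - d else if i < 3 * d then i - 2 * d
      else if i < 4 * d + 2 then i - 3 * d else i - (4 * d + 2))) [0..<n]"
  shows "s \<in> Bset n c" "s \<notin> Rset n c"
proof -
  have len: "length s = n" by (simp add: s_def)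
  \<comment> \<open>As \<open>d\<close> is odd, the blocks starting at \<open>d\<close> and
    \<open>3 * d\<close> begin at odd indices; \<open>h\<close> records the phase change of the
    alternating pattern there.\<close>
  define h :: "nat \<Rightarrow> nat" where "h i = of_bool (d \<le> i \<and> i < 2 * d \<or> 3 * d \<le> i \<and> i < 4 * d + 2)" for i
  have s: "s ! i \<longleftrightarrow> odd (i + h i)" if "i < n" for i
    using that d by (auto simp: s_def h_def)
  \<comment> \<open>This is \<open>v v u u\<close> started two letters later.\<close>
  define a where "a = rshift (2 * d + 2) s"
  have len_a: "length a = n" by (simp add: a_def len)
  define h' :: "nat \<Rightarrow> nat"
    where "h' i = of_bool (d \<le> i + 2 \<and> i < 2 * d \<or> 3 * d + 2 \<le> i \<and> i < 4 * d + 2)" for i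
  have a: "a ! i \<longleftrightarrow> odd (i + h' i)" if "i < n" for i
  proof (cases "i < 2 * d + 2")
    case True
    then have "a ! i = s ! (2 * d + 2 + i)"
      using that len n unfolding a_def by (subst nth_rshift) (auto simp: ac_simps)
    moreover have "h (2 * d + 2 + i) = h' i"
      using True unfolding h_def h'_def by (intro arg_cong[where f = of_bool]) linarith
    ultimately show ?thesis using s[of "2 * d + 2 + i"] True n by simp
  next
    case False
    have "a ! i = s ! (i - (2 * d + 2))"
      using False that len n unfolding a_def by (subst nth_rshift) auto
    moreover obtain j where j: "i = 2 * d + 2 + j" using False by (metis le_Suc_ex not_less)
    moreover have "h j = h' i"
      using that n d(2) unfolding j h_def h'_def by (intro arg_cong[where f = of_bool]) linarith
    ultimately show ?thesis using s[of j] that by simp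
  qed
  have mem_s: "s \<in> Bset_d n c d"
  proof (rule Bset_dI)
    show "aperiodic (take d s)"
    proof (rule ccontr)
      assume "\<not> aperiodic (take d s)"
      then obtain e where e: "1 \<le> e" "2 * e \<le> d" "e dvd d" "\<And>i. i + e < d \<Longrightarrow> s ! i = s ! (i + e)"
        unfolding aperiodic_def not_not using len n by (elim periodic_shift) auto
      have "even e" using e(1,2) e(4)[of 0] s[of 0] s[of e] n d by (simp add: h_def)
      then show False using e(3) d(1) by (meson dvd_trans)
    qed
    show "s ! i = s ! (i + d)" if "i + 1 < c" for i
    proof -
      have "i < n" "i + d < n" using that c n by linarith+
      moreover have "h i + h (i + d) = 1" using that c unfolding h_def by auto
      then have "odd (h i + h (i + d))" by simp
      ultimately show ?thesis using s[of i] s[of "i + d"] d by auto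
    qed
    show "s ! (c + d - 1) \<noteq> s ! (c - 1)"
      using s[of "c + d - 1"] s[of "c - 1"] d c n by (simp add: h_def)
  qed (use d len n c in auto)
  have mem_a: "a \<in> Bset_d n c (d + 2)"
  proof (rule Bset_dI)
    show "aperiodic (take (d + 2) a)"
    proof (rule ccontr)
      assume "\<not> aperiodic (take (d + 2) a)"
      then obtain e where e: "1 \<le> e" "2 * e \<le> d + 2" "e dvd d + 2" "\<And>i. i + e < d + 2 \<Longrightarrow> a ! i = a ! (i + e)"
        unfolding aperiodic_def not_not using len_a n by (elim periodic_shift) auto
      obtain q where q: "d + 2 = e * q" using e(3) by (elim dvdE)
      have "odd (e * q)" using d(1) by (simp flip: q)
      then have "odd e" "odd q" by auto
      have "q \<noteq> 1" using q e(2) by auto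
      then have "3 \<le> q" using \<open>odd q\<close> by presburger
      then have "e * 3 \<le> d + 2" unfolding q by (rule mult_le_mono2)
      show False
      \<comment> \<open>The root of \<open>a\<close> alternates on its first \<open>d - 2\<close>
        letters, which excludes smaller odd periods. What remains is \<open>d = 3\<close>,
        \<open>e = 1\<close>.\<close>
      proof (cases "e + 2 < d")
        case True
        then show False using e(4)[of 0] a[of 0] a[of e] n \<open>odd e\<close> d by (simp add: h'_def)
      next
        case False
        then have "e = 1" using \<open>e * 3 \<le> d + 2\<close> \<open>odd e\<close> d by presburger
        then show False using e(4)[of d] a[of d] a[of "d + 1"] n d by (simp add: h'_def)
      qed
    qed
    show "a ! i = a ! (i + (d + 2))" if "i + 1 < c" for i
    proof -
      have "i < n" "i + (d + 2) < n" using that c n by linarith+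
      moreover have "h' i + h' (i + (d + 2)) = 1" using that c unfolding h'_def by auto
      then have "odd (h' i + h' (i + (d + 2)))" by simp
      ultimately show ?thesis using a[of i] a[of "i + (d + 2)"] d by auto
    qed
    show "a ! (c + (d + 2) - 1) \<noteq> a ! (c - 1)"
      using a[of "c + (d + 2) - 1"] a[of "c - 1"] d c n by (simp add: h'_def)
  qed (use d len_a n c in auto)
  have "s ! (n - 1) \<noteq> s ! (d - 1)"
    using s[of "n - 1"] s[of "d - 1"] d n by (simp add: h_def)
  moreover have "a ! (n - 1) = a ! (d + 2 - 1)"
    using a[of "n - 1"] a[of "d + 2 - 1"] d n by (simp add: h'_def)
  ultimately show "s \<in> Bset n c" "s \<notin> Rset n c"
    using not_RsetI[OF mem_s mem_a[unfolded a_def]] spacing_eqI[OF mem_s] spacing_eqI[OF mem_a] n c d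
    by (auto simp: a_def)
qed

section \<open>The cases n = 6 and n = 8\<close>

lemma aperiodicI:
  assumes "\<And>e. 1 \<le> e \<Longrightarrow> 2 * e \<le> length u \<Longrightarrow> e dvd length u \<Longrightarrow> \<exists>i. i + e < length u \<and> u ! i \<noteq> u ! (i + e)"
  shows "aperiodic u"
  unfolding aperiodic_def using assms by (meson periodic_shift)

lemma all_less_numeral_iff:
  "(\<forall>i<numeral k. Q i) \<longleftrightarrow> (\<forall>i<pred_numeral k. Q i) \<and> Q (pred_numeral k)"
  by (auto simp: numeral_eq_Suc less_Suc_eq)

text \<open>Meant for \<open>n = 2 * c\<close>, where \<open>spacing_eqI\<close> does not apply: the
  other spacings are excluded one by one.\<close>

lemma mem_Bset_d_spacing_eq:
  assumes "length s = n" "aperiodic s" "aperiodic (take d s)" "1 \<le> c" "1 \<le> d" "d \<le> min (n - c) (n div 2)"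
    and "\<forall>i<c + d - 1. s ! i = s ! (i mod d)" "s ! (c + d - 1) \<noteq> s ! (c - 1)"
    and other: "\<And>e. 1 \<le> e \<Longrightarrow> e \<le> min (n - c) (n div 2) \<Longrightarrow> e \<noteq> d \<Longrightarrow> \<exists>i<c + e - 1. s ! i \<noteq> s ! (i mod e)"
  shows "s \<in> Bset_d n c d" "spacing n c s = d"
proof -
  show *: "s \<in> Bset_d n c d" using assms by (subst mem_Bset_d_iff) auto
  show "spacing n c s = d"
    unfolding spacing_def
  proof (rule the_equality)
    fix e assume "s \<in> Bset_d n c e"
    then show "e = d" using other[of e] mem_Bset_d_iff[OF assms(4)] by blast
  qed (rule *)
qed

text \<open>Again \<open>u u v v\<close>, now with \<open>u = [True]\<close> and
  \<open>v = [True, False]\<close>.\<close>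

lemma small_example_6: "\<exists>s. s \<in> Bset 6 3 \<and> s \<notin> Rset 6 3"
proof -
  let ?s = "[True, True, True, False, True, False]"
  let ?a = "[False, True, False, True, True, True]"
  have "aperiodic ?s"
  proof (rule aperiodicI)
    fix e assume "1 \<le> e" "2 * e \<le> length ?s"
    then have "e = 1 \<or> e = 2 \<or> e = 3" by auto
    then show "\<exists>i. i + e < length ?s \<and> ?s ! i \<noteq> ?s ! (i + e)"
      by (intro exI[of _ "3 - e"]) auto
  qed
  moreover have "aperiodic [True]" by (rule aperiodicI) simp
  moreover have "\<exists>i<3 + e - 1. ?s ! i \<noteq> ?s ! (i mod e)"
    if "1 \<le> e" "e \<le> min (6 - 3) (6 div 2)" "e \<noteq> 1" for e
  proof -
    have "e = 2 \<or> e = 3" using that by auto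
    then show ?thesis by (intro exI[of _ 3]) auto
  qed
  ultimately have s: "?s \<in> Bset_d 6 3 1" "spacing 6 3 ?s = 1"
    using mem_Bset_d_spacing_eq[where s = ?s and n = 6 and c = 3 and d = 1] by (simp_all add: all_less_numeral_iff)
  have "aperiodic ?a"
  proof (rule aperiodicI)
    fix e assume "1 \<le> e" "2 * e \<le> length ?a"
    then have "e = 1 \<or> e = 2 \<or> e = 3" by auto
    then show "\<exists>i. i + e < length ?a \<and> ?a ! i \<noteq> ?a ! (i + e)"
      by (intro exI[of _ "2"]) auto
  qed
  moreover have "aperiodic [False, True]"
  proof (rule aperiodicI)
    fix e assume "1 \<le> e" "2 * e \<le> length [False, True]"
    then have "e = 1" by auto
    then show "\<exists>i. i + e < length [False, True] \<and> [False, True] ! i \<noteq> [False, True] ! (i + e)"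
      by (intro exI[of _ "0"]) auto
  qed
  moreover have "\<exists>i<3 + e - 1. ?a ! i \<noteq> ?a ! (i mod e)"
    if "1 \<le> e" "e \<le> min (6 - 3) (6 div 2)" "e \<noteq> 2" for e
  proof -
    have "e = 1 \<or> e = 3" using that by auto
    then show ?thesis by (intro exI[of _ e]) auto
  qed
  ultimately have a: "?a \<in> Bset_d 6 3 2" "spacing 6 3 ?a = 2"
    using mem_Bset_d_spacing_eq[where s = ?a and n = 6 and c = 3 and d = 2] by (simp_all add: all_less_numeral_iff)
  have "rshift 3 ?s = ?a" by (simp add: rshift_def)
  then show ?thesis using not_RsetI[where s = ?s and n = 6 and c = 3 and d = 1 and k = 3 and e = 2] s a by auto
qed

text \<open>Here \<open>u = [False]\<close> and \<open>v = [False, False, True]\<close>.\<close>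

lemma small_example_8: "\<exists>s. s \<in> Bset 8 4 \<and> s \<notin> Rset 8 4"
proof -
  let ?s = "[False, False, False, False, True, False, False, True]"
  let ?a = "[True, False, False, True, False, False, False, False]"
  have "aperiodic ?s"
  proof (rule aperiodicI)
    fix e assume "1 \<le> e" "2 * e \<le> length ?s"
    then have "e = 1 \<or> e = 2 \<or> e = 3 \<or> e = 4" by auto
    then show "\<exists>i. i + e < length ?s \<and> ?s ! i \<noteq> ?s ! (i + e)"
      by (intro exI[of _ "4 - e"]) auto
  qed
  moreover have "aperiodic [False]" by (rule aperiodicI) simp
  moreover have "\<exists>i<4 + e - 1. ?s ! i \<noteq> ?s ! (i mod e)"
    if "1 \<le> e" "e \<le> min (8 - 4) (8 div 2)" "e \<noteq> 1" for e
  proof -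
    have "e = 2 \<or> e = 3 \<or> e = 4" using that by auto
    then show ?thesis by (intro exI[of _ 4]) auto
  qed
  ultimately have s: "?s \<in> Bset_d 8 4 1" "spacing 8 4 ?s = 1"
    using mem_Bset_d_spacing_eq[where s = ?s and n = 8 and c = 4 and d = 1] by (simp_all add: all_less_numeral_iff)
  have "aperiodic ?a"
  proof (rule aperiodicI)
    fix e assume "1 \<le> e" "2 * e \<le> length ?a"
    then have "e = 1 \<or> e = 2 \<or> e = 3 \<or> e = 4" by auto
    then show "\<exists>i. i + e < length ?a \<and> ?a ! i \<noteq> ?a ! (i + e)"
      by (intro exI[of _ "3"]) auto
  qed
  moreover have "aperiodic [True, False, False]"
  proof (rule aperiodicI)
    fix e assume "1 \<le> e" "2 * e \<le> length [True, False, False]"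
    then have "e = 1" by auto
    then show "\<exists>i. i + e < length [True, False, False] \<and> [True, False, False] ! i \<noteq> [True, False, False] ! (i + e)"
      by (intro exI[of _ "0"]) auto
  qed
  moreover have "\<exists>i<4 + e - 1. ?a ! i \<noteq> ?a ! (i mod e)"
    if "1 \<le> e" "e \<le> min (8 - 4) (8 div 2)" "e \<noteq> 3" for e
  proof -
    have "e = 1 \<or> e = 2 \<or> e = 4" using that by auto
    then show ?thesis by (intro exI[of _ e]) auto
  qed
  ultimately have a: "?a \<in> Bset_d 8 4 3" "spacing 8 4 ?a = 3"
    using mem_Bset_d_spacing_eq[where s = ?a and n = 8 and c = 4 and d = 3] by (simp_all add: all_less_numeral_iff)
  have "rshift 4 ?s = ?a" by (simp add: rshift_def)
  then show ?thesis using not_RsetI[where s = ?s and n = 8 and c = 4 and d = 1 and k = 4 and e = 3] s a by auto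
qed

subsection \<open>The bound\<close>

lemma c0_even_mod_8:
  "c0_even (8 * k) = 6 * k - 1" "c0_even (8 * k + 2) = 6 * k + 1"
  "c0_even (8 * k + 4) = 6 * k + 1" "c0_even (8 * k + 6) = 6 * k + 4"
proof -
  have "3 * (8 * k) div 4 = 6 * k" "3 * (8 * k + 2) div 4 = 6 * k + 1"
    "3 * (8 * k + 4) div 4 = 6 * k + 3" "3 * (8 * k + 6) div 4 = 6 * k + 4" by presburger+
  moreover have "8 * k mod 8 = 0" "(8 * k + 2) mod 8 = 2" "(8 * k + 4) mod 8 = 4" "(8 * k + 6) mod 8 = 6"
    by presburger+
  ultimately show "c0_even (8 * k) = 6 * k - 1" "c0_even (8 * k + 2) = 6 * k + 1"
    "c0_even (8 * k + 4) = 6 * k + 1" "c0_even (8 * k + 6) = 6 * k + 4"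
    unfolding c0_even_def by simp_all
qed

lemma even_mod_8_cases:
  fixes n :: nat
  assumes "even n"
  obtains k where "n = 8 * k" | k where "n = 8 * k + 2" | k where "n = 8 * k + 4" | k where "n = 8 * k + 6"
proof -
  have "n mod 8 = 0 \<or> n mod 8 = 2 \<or> n mod 8 = 4 \<or> n mod 8 = 6" using assms by presburger
  then show ?thesis using that mult_div_mod_eq[of 8 n] by (elim disjE) (metis add_0_right)+
qed

theorem theorem1:
  fixes n :: nat
  assumes "1 \<le> n"
  shows "(\<forall>c s. n div 2 \<le> c \<longrightarrow> 3 * n div 4 \<le> c \<longrightarrow> s \<in> Bset n c \<longrightarrow>
            s \<in> Rset n c \<and> nlc_inf (per_inf s) = nlc s + add n c s)
       \<and> (even n \<and> (n mod 8 = 4 \<longrightarrow> 20 \<le> n) \<longrightarrow>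
            (\<forall>c s. n div 2 \<le> c \<longrightarrow> c0_even n \<le> c \<longrightarrow> s \<in> Bset n c \<longrightarrow> s \<in> Rset n c)
          \<and> (n div 2 \<le> c0_even n - 1 \<longrightarrow>
               (\<exists>s. s \<in> Bset n (c0_even n - 1) \<and> s \<notin> Rset n (c0_even n - 1))))"
proof (intro conjI allI impI)
  fix c s
  assume c: "n div 2 \<le> c" "3 * n div 4 \<le> c" and "s \<in> Bset n c"
  then obtain d where "s \<in> Bset_d n c d" unfolding Bset_def by blast
  then interpret spaced n c d s using c(1) by unfold_locales
  have "2 \<le> n" using bounds by linarith
  have ineq: "3 * n \<le> 4 * c + 3" using c(2) by linarith
  then have hyps: "n \<le> 2 * c" "2 * n \<le> 3 * c + 1" "5 * n \<le> 7 * c + 9" "n < 2 * c \<or> n \<le> 3"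
    using \<open>2 \<le> n\<close> by linarith+
  show "s \<in> Rset n c" using hyps ineq by (intro Rset_member) auto
  have "nlc_inf (per_inf s) = c + t"
    by (intro nlc_inf_eq gap_bound) (use hyps ineq in auto)
  then show "nlc_inf (per_inf s) = nlc s + add n c s"
    using nlc_eq add_eq hyps by simp
next
  fix c s
  assume n: "even n \<and> (n mod 8 = 4 \<longrightarrow> 20 \<le> n)"
    and c: "n div 2 \<le> c" "c0_even n \<le> c" and "s \<in> Bset n c"
  then obtain d where "s \<in> Bset_d n c d" unfolding Bset_def by blast
  then interpret spaced n c d s using c(1) by unfold_locales
  have "2 \<le> n" using bounds by linarith
  have "even n" using n by blast
  then have "n \<le> 2 * c \<and> 2 * n \<le> 3 * c + 1 \<and> 5 * n \<le> 7 * c + 9 \<and> (n < 2 * c \<or> n \<le> 3) \<and>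
    (3 * n \<le> 4 * c + 5 \<or> n mod 8 = 4 \<and> 3 * n \<le> 4 * c + 8)"
  proof (cases rule: even_mod_8_cases)
    case (1 k)
    then have "6 * k \<le> c + 1" "1 \<le> k" using c(2) \<open>2 \<le> n\<close> by (auto simp: c0_even_mod_8(1))
    then show ?thesis using 1 by linarith
  next
    case (2 k)
    have "6 * k + 1 \<le> c" using c(2) unfolding 2 c0_even_mod_8 .
    then show ?thesis using 2 by linarith
  next
    case (3 k)
    have "n mod 8 = 4" unfolding 3 by presburger
    moreover have "6 * k + 1 \<le> c" using c(2) unfolding 3 c0_even_mod_8 .
    \<comment> \<open>At \<open>c = 6 * k + 1\<close> both \<open>2 * n \<le> 3 * c + 1\<close> and
      \<open>5 * n \<le> 7 * c + 9\<close> amount to \<open>2 \<le> k\<close>; this is where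
      \<open>20 \<le> n\<close> enters.\<close>
    moreover have "2 \<le> k" using n calculation 3 by linarith
    ultimately show ?thesis using 3 by linarith
  next
    case (4 k)
    have "6 * k + 4 \<le> c" using c(2) unfolding 4 c0_even_mod_8 .
    then show ?thesis using 4 by linarith
  qed
  then show "s \<in> Rset n c" by (intro Rset_member) auto
next
  assume n: "even n \<and> (n mod 8 = 4 \<longrightarrow> 20 \<le> n)" and half: "n div 2 \<le> c0_even n - 1"
  have "even n" using n by blast
  then show "\<exists>s. s \<in> Bset n (c0_even n - 1) \<and> s \<notin> Rset n (c0_even n - 1)"
  \<comment> \<open>The distances add up to \<open>n / 2\<close>. If this is odd they differ by 1,
    otherwise by 2. In the latter case they are odd with overlap 1 for \<open>n = 8 * k\<close>, and
    even with overlap 2 for \<open>n = 8 * k + 4\<close>.\<close>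
  proof (cases rule: even_mod_8_cases)
    case (1 k)
    have c0: "c0_even n - 1 = 6 * k - 2" "1 \<le> k"
      using 1 assms unfolding 1(1) c0_even_mod_8 by linarith+
    show ?thesis
    proof (cases "k = 1")
      case True
      then show ?thesis using small_example_8 1 c0 by simp
    next
      case False
      then have "odd (2 * k - 1)" "3 \<le> 2 * k - 1" "n = 4 * (2 * k - 1) + 4" "6 * k - 2 = 3 * (2 * k - 1) + 1"
        using 1 c0(2) by auto
      then show ?thesis unfolding c0(1) using alternating_example by blast
    qed
  next
    case (2 k)
    have c0: "c0_even n - 1 = 6 * k" "1 \<le> k" using half unfolding 2 c0_even_mod_8 by linarith+
    have "1 < 2 * k" "n = 4 * (2 * k) + 2 * 1" "6 * k = 3 * (2 * k)" "n < 2 * (6 * k)"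
      using 2 c0(2) by auto
    then show ?thesis unfolding c0(1) using four_ones_example[OF order.refl] by blast
  next
    case (3 k)
    have "n mod 8 = 4" unfolding 3 by presburger
    then have c0: "c0_even n - 1 = 6 * k" "2 \<le> k" using n unfolding 3 c0_even_mod_8 by linarith+
    have "2 < 2 * k" "n = 4 * (2 * k) + 2 * 2" "6 * k = 3 * (2 * k)" "n < 2 * (6 * k)"
      using 3 c0(2) by auto
    then show ?thesis unfolding c0(1) using four_ones_example[OF one_le_numeral] by blast
  next
    case (4 k)
    have c0: "c0_even n - 1 = 6 * k + 3" unfolding 4 c0_even_mod_8 by linarith
    show ?thesis
    proof (cases "k = 0")
      case True
      then show ?thesis using small_example_6 4 c0 by simp
    next
      case False
      then have "1 < 2 * k + 1" "n = 4 * (2 * k + 1) + 2 * 1" "6 * k + 3 = 3 * (2 * k + 1)" "n < 2 * (6 * k + 3)"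
        using 4 by auto
      then show ?thesis unfolding c0(1) using four_ones_example[OF order.refl] by blast
    qed
  qed
qed

end
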